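(* For every positive integer $\gamma$ we have $\Xi(\gamma)\le 4\gamma$. Equivalently, every finite simple connected bridgeless graph $G$ has a strongly connected orientation of diameter at most $4\gamma(G)$.
   Context: All graphs are finite, simple and undirected. A graph is bridgeless connected if it is connected and stays connected after deleting any single edge. An orientation of $G$ assigns a direction to every edge; it is strongly connected if every vertex reaches every other vertex by a directed path. For a strongly connected digraph $H$, $d_H(u,v)$ is the number of arcs of a shortest directed path from $u$ to $v$, and $diam(H)=\max_{u,v}d_H(u,v)$. For a bridgeless connected graph $G$, $\overset{\longrightarrow}{diam}_{min}(G)$ is the minimum of $diam(H)$ over all strongly connected orientations $H$ of $G$. A dominating set of $G$ is a set $D\subseteq V(G)$ such that every vertex outside $D$ has a neighbor in $D$; $\gamma(G)$ denotes the minimum cardinality of a dominating set of $G$. For a positive integer $\gamma$, $\Xi(\gamma)=\max\{\overset{\longrightarrow}{diam}_{min}(G): G \text{ bridgeless connected}, \gamma(G)\le\gamma\}$. *)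

theory Defs
  imports "Graph_Theory.Graph_Theory" "HOL-Library.Extended_Nat"
begin

text \<open>
  Finite simple undirected graphs are the \<^locale>\<open>pair_graph\<close>s of the AFP entry Graph_Theory:
  finite loop-free digraphs without parallel arcs whose arc relation is symmetric.
  The undirected edge between \<open>u\<close> and \<open>v\<close> is the pair of arcs \<open>(u, v)\<close>, \<open>(v, u)\<close>, so deleting
  an edge means deleting both arcs.
  The null graph is neither connected nor strongly connected in that library.
\<close>

definition delete_edge :: "'a pair_pre_digraph \<Rightarrow> 'a \<Rightarrow> 'a \<Rightarrow> 'a pair_pre_digraph" where
  "delete_edge G u v = G\<lparr>parcs := parcs G - {(u, v), (v, u)}\<rparr>"

definition bridgeless_connected :: "'a pair_pre_digraph \<Rightarrow> bool" where
  "bridgeless_connected G \<longleftrightarrow>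
     pair_graph G \<and> Digraph_Component.connected (with_proj G) \<and>
     (\<forall>(u, v) \<in> parcs G. Digraph_Component.connected (with_proj (delete_edge G u v)))"

definition orientation :: "'a pair_pre_digraph \<Rightarrow> 'a pair_pre_digraph \<Rightarrow> bool" where
  "orientation G H \<longleftrightarrow>
     pverts H = pverts G \<and> parcs H \<subseteq> parcs G \<and>
     (\<forall>(u, v) \<in> parcs G. (u, v) \<in> parcs H \<longleftrightarrow> (v, u) \<notin> parcs H)"

definition strong_orientation :: "'a pair_pre_digraph \<Rightarrow> 'a pair_pre_digraph \<Rightarrow> bool" where
  "strong_orientation G H \<longleftrightarrow> orientation G H \<and> strongly_connected (with_proj H)"

text \<open>
  Distances and diameters are taken in \<^typ>\<open>enat\<close>, so that an infimum over no paths (or no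
  orientations) and a supremum of unbounded values are \<open>\<infinity>\<close> rather than an arbitrary number.
  A finite infimum in \<^typ>\<open>enat\<close> is a minimum, and a finite supremum of a nonempty set is a maximum.
\<close>

definition directed_dist :: "'a pair_pre_digraph \<Rightarrow> 'a \<Rightarrow> 'a \<Rightarrow> enat" where
  "directed_dist H u v = (INF p \<in> {p. pre_digraph.apath (with_proj H) u p v}. enat (length p))"

definition directed_diam :: "'a pair_pre_digraph \<Rightarrow> enat" where
  "directed_diam H = (SUP u \<in> pverts H. SUP v \<in> pverts H. directed_dist H u v)"

definition min_oriented_diam :: "'a pair_pre_digraph \<Rightarrow> enat" where
  "min_oriented_diam G = (INF H \<in> {H. strong_orientation G H}. directed_diam H)"

definition dominating_set :: "'a pair_pre_digraph \<Rightarrow> 'a set \<Rightarrow> bool" where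
  "dominating_set G D \<longleftrightarrow>
     D \<subseteq> pverts G \<and> (\<forall>v \<in> pverts G - D. \<exists>u \<in> D. (v, u) \<in> parcs G)"

definition domination_number :: "'a pair_pre_digraph \<Rightarrow> nat" where
  "domination_number G = Min (card ` {D. dominating_set G D})"

text \<open>
  Every finite graph is isomorphic to one with vertices in \<^typ>\<open>nat\<close>, so ranging over the latter
  ranges over all graphs up to isomorphism.
\<close>

definition Xi :: "nat \<Rightarrow> enat" where
  "Xi \<gamma> = (SUP G \<in> {G :: nat pair_pre_digraph.
                     bridgeless_connected G \<and> domination_number G \<le> \<gamma>}. min_oriented_diam G)"

text \<open>
  The remaining lemmas confirm that the infima and suprema above are the minima and maxima
  they stand for (for the diameter this is clear: the vertex set is finite and nonempty).
\<close>

lemma enat_Inf_attained: "A \<noteq> {} \<Longrightarrow> Inf A \<in> A" for A :: "enat set"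
  using wellorder_InfI by blast

lemma enat_Sup_attained:
  fixes A :: "enat set"
  assumes "A \<noteq> {}" "Sup A \<noteq> \<infinity>"
  shows "Sup A \<in> A"
proof -
  have "finite A"
    using assms by (auto simp: Sup_enat_def split: if_splits)
  then show ?thesis
    using assms(1) Max_in[of A] by (simp add: Sup_enat_def)
qed

lemma directed_dist_attained:
  assumes "pair_wf_digraph H" "strongly_connected (with_proj H)" "u \<in> pverts H" "v \<in> pverts H"
  shows "\<exists>p. pre_digraph.apath (with_proj H) u p v \<and> directed_dist H u v = enat (length p)"
proof -
  interpret pair_wf_digraph H by fact
  have "u \<rightarrow>\<^sup>*\<^bsub>with_proj H\<^esub> v"
    using assms by (auto simp: strongly_connected_def)
  then have "{p. apath u p v} \<noteq> {}"
    by (auto simp: reachable_apath)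
  then show ?thesis
    using enat_Inf_attained[of "(\<lambda>p. enat (length p)) ` {p. apath u p v}"]
    by (auto simp: directed_dist_def)
qed

lemma min_oriented_diam_attained:
  assumes "strong_orientation G H"
  shows "\<exists>H. strong_orientation G H \<and> min_oriented_diam G = directed_diam H"
  using enat_Inf_attained[of "directed_diam ` {H. strong_orientation G H}"] assms
  by (auto simp: min_oriented_diam_def)

lemma Xi_attained:
  assumes "\<gamma> \<ge> 1" "Xi \<gamma> \<noteq> \<infinity>"
  shows "\<exists>G :: nat pair_pre_digraph. bridgeless_connected G \<and> domination_number G \<le> \<gamma> \<and>
           Xi \<gamma> = min_oriented_diam G"
proof -
  let ?K = "\<lparr>pverts = {0}, parcs = {}\<rparr> :: nat pair_pre_digraph"
  have "pair_graph ?K"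
    by unfold_locales (auto simp: symmetric_def)
  moreover have "Digraph_Component.connected (with_proj ?K)"
    by (auto simp: Digraph_Component.connected_def strongly_connected_def mk_symmetric_def reachable_def)
  ultimately have "bridgeless_connected ?K"
    by (simp add: bridgeless_connected_def)
  moreover have "{D. dominating_set ?K D} = {{0}}"
    by (auto simp: dominating_set_def)
  then have "domination_number ?K = 1"
    by (simp add: domination_number_def)
  ultimately have "{G :: nat pair_pre_digraph. bridgeless_connected G \<and> domination_number G \<le> \<gamma>} \<noteq> {}"
    using assms(1) by (metis (mono_tags, lifting) empty_iff mem_Collect_eq)
  then show ?thesis
    using enat_Sup_attained[of "min_oriented_diam ` {G :: nat pair_pre_digraph.
            bridgeless_connected G \<and> domination_number G \<le> \<gamma>}"] assms(2)
    by (auto simp: Xi_def)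
qed

end

(*
  Grow a strongly oriented subgraph U from one dominating vertex by adding ears.  Give a vertex weight
  f = 2 if it lies in D and f = 1 otherwise, and keep d(u, v) + f(u) + f(v) <= 4 |D \<inter> U| for all
  u, v in U.  An ear with j new dominating vertices and m inner vertices preserves this bound once
  m <= 3j + (f(u) - 1) + (f(v) - 1) at its ends u, v; the weights are what makes long ears between
  dominating vertices harmless.  An ear that minimises the number of vertices outside D, and among
  those maximises the number in D, satisfies the estimate up to vertices whose dominator lies off the
  ear.  Each such dominator is paid for in advance: one unit if it can be reached by a later ear, two
  units if it hangs behind a cut vertex (a hook), whose weight is then raised to 2.
  Once D is contained in U, every remaining vertex is joined to U in both directions by paths of
  length at most f of their end, which turns the invariant into the diameter bound 4 |D|.
*)
theory Submission
  imports Defs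
begin

text \<open>Each new vertex of \<open>D\<close> brings four units. Three pay for the vertex itself
  and its two neighbours on the ear. The fourth pays for weights: without raised weights, two
  distinct ear vertices weigh together at most 2 plus the number of ear vertices in
  \<open>D\<close>. An end of the ear gives one unit by default, and a second one if it lies in
  \<open>D\<close>, which pays for an ear vertex dominated from \<open>U\<close>. The obstacle is an
  ear vertex whose dominator is neither on the ear nor in \<open>U\<close>. Its cost has to be
  charged to a vertex of \<open>D\<close> that joins later, so the bound runs ahead of
  \<open>4 * card (D \<inter> U)\<close> and the debt must be certain to be repaid. For a hook the
  two units are one for its place on the ear and one for its raised weight. The raised weight is
  itself the means of repayment: every ear into the component behind the hook starts and ends there,
  so the surplus weight counts at both ends, and resetting it to 1 afterwards returns exactly two
  units. The same weights serve the final stage: 1 or 2 is the length of detour that may be appended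
  at a vertex.\<close>

lemma rtrancl_obtain_path:
  assumes "(x, y) \<in> R\<^sup>*"
  obtains ps where "ps \<noteq> []" "hd ps = x" "last ps = y" "distinct ps"
    "successively (\<lambda>a b. (a, b) \<in> R) ps" "\<And>z. z \<in> set ps \<Longrightarrow> (x, z) \<in> R\<^sup>*"
proof -
  have "\<exists>ps. ps \<noteq> [] \<and> hd ps = x \<and> last ps = y \<and> distinct ps \<and>
    successively (\<lambda>a b. (a, b) \<in> R) ps \<and> (\<forall>z\<in>set ps. (x, z) \<in> R\<^sup>*)"
    using assms
  proof (induction rule: rtrancl_induct)
    case base
    show ?case by (rule exI[of _ "[x]"]) auto
  next
    case (step y z)
    then obtain ps where ps: "ps \<noteq> []" "hd ps = x" "last ps = y" "distinct ps"
      "successively (\<lambda>a b. (a, b) \<in> R) ps" "\<forall>z\<in>set ps. (x, z) \<in> R\<^sup>*" by blast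
    show ?case
    proof (cases "z \<in> set ps")
      case True
      then obtain as bs where "ps = as @ z # bs" by (meson split_list)
      with ps show ?thesis
        by (intro exI[of _ "as @ [z]"]) (auto simp: successively_append_iff hd_append)
    next
      case False
      with ps step show ?thesis
        by (intro exI[of _ "ps @ [z]"]) (auto simp: successively_append_iff)
    qed
  qed
  with that show thesis by blast
qed

lemma rtrancl_first_hit:
  assumes "(x, y) \<in> R\<^sup>*" "x \<notin> U" "y \<in> U"
  obtains w v where "(x, w) \<in> (R \<inter> (- U) \<times> (- U))\<^sup>*" "w \<notin> U" "(w, v) \<in> R" "v \<in> U"
proof -
  have "x \<notin> U \<longrightarrow> (\<exists>w v. (x, w) \<in> (R \<inter> (- U) \<times> (- U))\<^sup>* \<and> w \<notin> U \<and> (w, v) \<in> R \<and> v \<in> U)"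
    using assms(1)
  proof (induction rule: converse_rtrancl_induct)
    case base
    show ?case using assms(3) by blast
  next
    case (step a b)
    show ?case
    proof (cases "b \<in> U")
      case True
      then show ?thesis using step by blast
    next
      case False
      with step obtain w v where "(b, w) \<in> (R \<inter> (- U) \<times> (- U))\<^sup>*" "w \<notin> U" "(w, v) \<in> R" "v \<in> U"
        by blast
      moreover have "a \<notin> U \<longrightarrow> (a, b) \<in> R \<inter> (- U) \<times> (- U)" using step False by auto
      ultimately show ?thesis by (meson converse_rtrancl_into_rtrancl)
    qed
  qed
  with assms that show thesis by blast
qed

lemma split_list_two:
  assumes "i < l" "l < length ps"
  obtains xs zs ys where "ps = xs @ ps ! i # zs @ ps ! l # ys"
    "zs = [] \<longleftrightarrow> l = Suc i" "zs \<noteq> [] \<Longrightarrow> hd zs = ps ! Suc i" "zs \<noteq> [] \<Longrightarrow> last zs = ps ! (l - 1)"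
proof -
  let ?xs = "take i ps" and ?zs = "take (l - Suc i) (drop (Suc i) ps)" and ?ys = "drop (Suc l) ps"
  have "drop (Suc i) ps = ?zs @ drop (l - Suc i) (drop (Suc i) ps)"
    by (simp only: append_take_drop_id)
  also have "drop (l - Suc i) (drop (Suc i) ps) = drop l ps" using assms by simp
  also have "\<dots> = ps ! l # ?ys" using assms by (simp add: Cons_nth_drop_Suc)
  finally have 1: "drop (Suc i) ps = ?zs @ ps ! l # ?ys" .
  have 2: "ps = ?xs @ ps ! i # drop (Suc i) ps" using assms by (simp add: id_take_nth_drop)
  show thesis
  proof (rule that[of ?xs ?zs ?ys])
    show "ps = ?xs @ ps ! i # ?zs @ ps ! l # ?ys" using 1 2 by simp
    show "?zs = [] \<longleftrightarrow> l = Suc i" using assms by auto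
    show "hd ?zs = ps ! Suc i" if "?zs \<noteq> []" using that assms by (auto simp: hd_drop_conv_nth hd_take)
    show "last ?zs = ps ! (l - 1)" if "?zs \<noteq> []"
    proof -
      have "Suc (l - 2) = l - 1" using that assms by simp
      then show ?thesis using that assms by (auto simp: last_conv_nth min_def)
    qed
  qed
qed

lemma nth_in_set_take: "k < i \<Longrightarrow> i \<le> length xs \<Longrightarrow> xs ! k \<in> set (take i xs)"
  by (auto simp: in_set_conv_nth intro!: exI[of _ k])

lemma nth_in_set_drop: "i \<le> k \<Longrightarrow> k < length xs \<Longrightarrow> xs ! k \<in> set (drop i xs)"
  by (auto simp: in_set_conv_nth intro!: exI[of _ "k - i"])

lemma relpow_mono_subset: "A \<subseteq> B \<Longrightarrow> (x, y) \<in> A ^^ k \<Longrightarrow> (x, y) \<in> B ^^ k" for A B :: "('a \<times> 'a) set"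
  by (induction k arbitrary: y) (simp, auto simp: relcomp_unfold)

lemma relpow_trans: "(x, y) \<in> A ^^ k \<Longrightarrow> (y, z) \<in> A ^^ l \<Longrightarrow> (x, z) \<in> A ^^ (k + l)" for A :: "('a \<times> 'a) set"
  by (auto simp: relpow_add)

section \<open>Components outside \<open>U\<close>, ears, and routings with bounded
  distances\<close>

locale bridgeless_dominated_graph =
  fixes V :: "'a set" and E :: "('a \<times> 'a) set" and D :: "'a set"
  assumes finite_V: "finite V"
    and V_nonempty: "V \<noteq> {}"
    and E_subset: "E \<subseteq> V \<times> V"
    and E_sym: "(x, y) \<in> E \<Longrightarrow> (y, x) \<in> E"
    and E_irrefl: "(x, x) \<notin> E"
    and connected: "x \<in> V \<Longrightarrow> y \<in> V \<Longrightarrow> (x, y) \<in> E\<^sup>*"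
    and bridgeless: "(x, y) \<in> E \<Longrightarrow> (x, y) \<in> (E - {(x, y), (y, x)})\<^sup>*"
    and D_subset: "D \<subseteq> V"
    and dominated: "x \<in> V - D \<Longrightarrow> \<exists>d\<in>D. (x, d) \<in> E"
begin

abbreviation linked :: "'a list \<Rightarrow> bool" where
  "linked \<equiv> successively (\<lambda>x y. (x, y) \<in> E)"

lemma linked_rev: "linked (rev xs) \<longleftrightarrow> linked xs"
proof -
  have "linked (rev xs) \<longleftrightarrow> successively (\<lambda>x y. (y, x) \<in> E) xs" by simp
  also have "\<dots> \<longleftrightarrow> linked xs" using E_sym by (intro successively_cong) auto
  finally show ?thesis .
qed

definition outside :: "'a set \<Rightarrow> ('a \<times> 'a) set" where
  "outside U = E \<inter> (- U) \<times> (- U)"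

text \<open>For a vertex \<open>z\<close> outside \<open>U\<close> this is the component of the
  graph minus \<open>U\<close> that contains \<open>z\<close>. For \<open>z\<close> in
  \<open>U\<close> it degenerates to \<open>{z}\<close>, hence the assumption
  \<open>z \<notin> U\<close> in several lemmas.\<close>

definition comp :: "'a set \<Rightarrow> 'a \<Rightarrow> 'a set" where
  "comp U z = {w. (z, w) \<in> (outside U)\<^sup>*}"

lemma outside_sym: "(x, y) \<in> (outside U)\<^sup>* \<Longrightarrow> (y, x) \<in> (outside U)\<^sup>*"
proof -
  have "sym (outside U)" unfolding outside_def sym_def using E_sym by auto
  then have "sym ((outside U)\<^sup>*)" by (rule sym_rtrancl)
  then show "(x, y) \<in> (outside U)\<^sup>* \<Longrightarrow> (y, x) \<in> (outside U)\<^sup>*" by (meson symE)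
qed

lemma comp_self: "z \<in> comp U z"
  by (simp add: comp_def)

lemma comp_outside: "z \<notin> U \<Longrightarrow> w \<in> comp U z \<Longrightarrow> w \<notin> U"
  unfolding comp_def mem_Collect_eq by (erule rtrancl_induct) (auto simp: outside_def)

lemma comp_closed: "z \<notin> U \<Longrightarrow> x \<in> comp U z \<Longrightarrow> (x, y) \<in> E \<Longrightarrow> y \<notin> U \<Longrightarrow> y \<in> comp U z"
  using comp_outside[of z U x] unfolding comp_def mem_Collect_eq
  by (metis (no_types, lifting) ComplI IntI SigmaI outside_def rtrancl.rtrancl_into_rtrancl)

lemma comp_eq: "w \<in> comp U z \<Longrightarrow> comp U w = comp U z"
  unfolding comp_def using outside_sym[of z w U] by (auto intro: rtrancl_trans)

lemma comp_mono: "U \<subseteq> U' \<Longrightarrow> comp U' z \<subseteq> comp U z"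
proof -
  assume "U \<subseteq> U'"
  then have "outside U' \<subseteq> outside U" by (auto simp: outside_def)
  then show ?thesis unfolding comp_def using rtrancl_mono by blast
qed

lemma comp_path:
  assumes "z \<notin> U" "w \<in> comp U z"
  obtains ps where "ps \<noteq> []" "hd ps = z" "last ps = w" "distinct ps" "linked ps"
    "set ps \<subseteq> comp U z" "set ps \<inter> U = {}"
proof -
  have zw: "(z, w) \<in> (outside U)\<^sup>*" using assms by (simp add: comp_def)
  obtain ps where ps: "ps \<noteq> []" "hd ps = z" "last ps = w" "distinct ps"
    "successively (\<lambda>a b. (a, b) \<in> outside U) ps" "\<And>x. x \<in> set ps \<Longrightarrow> (z, x) \<in> (outside U)\<^sup>*"
    using rtrancl_obtain_path[OF zw] by blast
  have "linked ps" by (rule successively_mono[OF ps(5)]) (auto simp: outside_def)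
  moreover have "set ps \<subseteq> comp U z" using ps(6) by (auto simp: comp_def)
  ultimately show thesis using that ps comp_outside[OF assms(1)] by blast
qed

lemma comp_attached:
  assumes "z \<in> V" "z \<notin> U" "U \<subseteq> V" "U \<noteq> {}"
  obtains w v where "w \<in> comp U z" "v \<in> U" "(w, v) \<in> E"
proof -
  obtain u where "u \<in> U" using assms by blast
  then have "(z, u) \<in> E\<^sup>*" using connected assms by blast
  then show thesis using rtrancl_first_hit[OF _ assms(2) \<open>u \<in> U\<close>] that
    unfolding comp_def outside_def by blast
qed

text \<open>The list holds the inner vertices only. Closed ears with \<open>u = v\<close> are
  allowed, except for a single inner vertex, where both end edges would be the same edge.\<close>

definition ear :: "'a set \<Rightarrow> 'a \<Rightarrow> 'a list \<Rightarrow> 'a \<Rightarrow> bool" where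
  "ear U u ps v \<longleftrightarrow> ps \<noteq> [] \<and> distinct ps \<and> set ps \<inter> U = {} \<and> u \<in> U \<and> v \<in> U \<and>
     (u, hd ps) \<in> E \<and> linked ps \<and> (last ps, v) \<in> E \<and> (length ps = 1 \<longrightarrow> u \<noteq> v)"

lemma ear_rev: "ear U u ps v \<Longrightarrow> ear U v (rev ps) u"
  unfolding ear_def using linked_rev[of ps] E_sym by (auto simp: hd_rev last_rev)

lemma ear_V: "ear U u ps v \<Longrightarrow> set ps \<subseteq> V"
proof -
  assume "ear U u ps v"
  then have "hd ps \<in> V" "linked ps" using E_subset by (auto simp: ear_def)
  then show ?thesis using E_subset by (induction ps rule: induct_list012) auto
qed

text \<open>Bridgelessness lets every edge leaving \<open>U\<close> begin an ear: follow a path from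
  \<open>z\<close> back to \<open>u\<close> that avoids this edge until it first meets
  \<open>U\<close>. If that happens directly after \<open>z\<close>, it happens at a vertex other
  than \<open>u\<close>.\<close>

lemma ear_through_edge:
  assumes "u \<in> U" "z \<notin> U" "(u, z) \<in> E"
  obtains ps v where "ear U u ps v" "hd ps = z" "set ps \<subseteq> comp U z"
proof -
  let ?R = "E - {(z, u), (u, z)}"
  have "(z, u) \<in> ?R\<^sup>*" using bridgeless E_sym assms(3) by blast
  then obtain w v where w: "(z, w) \<in> (?R \<inter> (- U) \<times> (- U))\<^sup>*" "w \<notin> U" "(w, v) \<in> ?R" "v \<in> U"
    using rtrancl_first_hit assms by metis
  obtain ps where ps: "ps \<noteq> []" "hd ps = z" "last ps = w" "distinct ps"
    "successively (\<lambda>a b. (a, b) \<in> ?R \<inter> (- U) \<times> (- U)) ps"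
    "\<And>x. x \<in> set ps \<Longrightarrow> (z, x) \<in> (?R \<inter> (- U) \<times> (- U))\<^sup>*"
    using rtrancl_obtain_path[OF w(1)] by blast
  have "linked ps" by (rule successively_mono[OF ps(5)]) auto
  have "(?R \<inter> (- U) \<times> (- U))\<^sup>* \<subseteq> (outside U)\<^sup>*" by (rule rtrancl_mono) (auto simp: outside_def)
  then have c: "set ps \<subseteq> comp U z" using ps(6) by (auto simp: comp_def)
  have "set ps \<inter> U = {}" using c comp_outside assms by blast
  moreover have "length ps = 1 \<longrightarrow> u \<noteq> v" using ps(1-3) w(3) by (cases ps) auto
  ultimately have "ear U u ps v" unfolding ear_def using ps \<open>linked ps\<close> w assms by auto
  then show thesis using that ps c by blast
qed

text \<open>
  The bound is written without subtraction: the distance between \<open>x\<close> and \<open>y\<close> is at most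
  \<open>b - f x - f y\<close>.
\<close>

definition routed :: "'a set \<Rightarrow> ('a \<Rightarrow> nat) \<Rightarrow> nat \<Rightarrow> bool" where
  "routed U f b \<longleftrightarrow> (\<exists>A \<subseteq> E \<inter> U \<times> U. (\<forall>x y. (x, y) \<in> A \<longrightarrow> (y, x) \<notin> A) \<and>
     (\<forall>x\<in>U. \<forall>y\<in>U. \<exists>k. (x, y) \<in> A ^^ k \<and> k + f x + f y \<le> b))"

text \<open>The ear is oriented from \<open>u\<close> to \<open>v\<close>. Condition
  \<open>last\<close> bounds routes from \<open>U\<close> into the ear, \<open>hd\<close> routes
  from the ear into \<open>U\<close>, and \<open>pair\<close> routes between two ear vertices, where
  going backwards means leaving at \<open>v\<close>, crossing \<open>U\<close> and re-entering at
  \<open>u\<close>. The bound \<open>4 \<le> c\<close> is for the pairs \<open>(x, x)\<close>, which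
  weigh up to 4 at distance 0.\<close>

lemma ear_extend:
  assumes routed: "routed U f b" and ear: "ear U u ps v"
    and g_le: "\<And>x. x \<in> U \<Longrightarrow> g x \<le> f x"
    and g_ear: "\<And>x. x \<in> set ps \<Longrightarrow> 1 \<le> g x \<and> g x \<le> 2"
    and b: "b \<le> c" "4 \<le> c"
    and last: "length ps + g (last ps) + b \<le> c + f u"
    and hd: "length ps + g (hd ps) + b \<le> c + f v"
    and pair: "\<And>x y. x \<in> set ps \<Longrightarrow> y \<in> set ps \<Longrightarrow> x \<noteq> y \<Longrightarrow>
                 length ps + g x + g y + b \<le> c + f u + f v"
  shows "routed (U \<union> set ps) g c"
proof -
  obtain A where A: "A \<subseteq> E \<inter> U \<times> U" "\<forall>x y. (x, y) \<in> A \<longrightarrow> (y, x) \<notin> A"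
    "\<forall>x\<in>U. \<forall>y\<in>U. \<exists>k. (x, y) \<in> A ^^ k \<and> k + f x + f y \<le> b"
    using routed unfolding routed_def by (elim exE conjE)
  let ?m = "length ps"
  let ?l = "u # ps @ [v]"
  have e: "ps \<noteq> []" "distinct ps" "set ps \<inter> U = {}" "u \<in> U" "v \<in> U" "linked ?l" "?m = 1 \<longrightarrow> u \<noteq> v"
    using ear unfolding ear_def by (simp_all add: successively_Cons successively_append_iff)
  define B where "B = {(?l ! i, ?l ! Suc i) | i. i \<le> ?m}"
  have l_in: "?l ! i \<in> set ps" if "1 \<le> i" "i \<le> ?m" for i
    using that by (cases i) (auto simp: nth_append)
  have l_nth: "?l ! Suc i = ps ! i" if "i < ?m" for i
    using that by (simp add: nth_append)
  have l_v: "?l ! Suc ?m = v" by (simp add: nth_append)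
  have B_E: "B \<subseteq> E"
    using e(6) unfolding B_def successively_conv_nth by (auto simp del: nth_Cons_Suc)
  have B_U: "B \<subseteq> (U \<union> set ps) \<times> (U \<union> set ps)"
  proof -
    have "set ?l \<subseteq> U \<union> set ps" using e by auto
    moreover have "?l ! i \<in> set ?l" "?l ! Suc i \<in> set ?l" if "i \<le> ?m" for i
      by (rule nth_mem, use that in simp)+
    ultimately show ?thesis unfolding B_def by blast
  qed
  have l_U: "?l ! 0 \<in> U" "?l ! Suc ?m \<in> U" using e(4,5) l_v by simp_all
  have l_inner: "i = k" if r: "1 \<le> i" "i \<le> ?m" "1 \<le> k" "k \<le> ?m" "?l ! i = ?l ! k" for i k
  proof -
    obtain i' where i': "i = Suc i'" using r(1) by (cases i) auto
    obtain k' where k': "k = Suc k'" using r(3) by (cases k) auto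
    have "ps ! i' = ps ! k'" using l_nth[of i'] l_nth[of k'] r(2,4,5) unfolding i' k' by simp
    then show ?thesis using i' k' r(2,4) e(2) by (simp add: nth_eq_iff_index_eq)
  qed
  have l_inj: "i = k \<or> i = 0 \<and> k = Suc ?m \<or> i = Suc ?m \<and> k = 0"
    if "i \<le> Suc ?m" "k \<le> Suc ?m" and eq: "?l ! i = ?l ! k" for i k
  proof -
    have i: "i = 0 \<or> i = Suc ?m \<or> 1 \<le> i \<and> i \<le> ?m" and k: "k = 0 \<or> k = Suc ?m \<or> 1 \<le> k \<and> k \<le> ?m"
      using that by linarith+
    have "\<not> (1 \<le> i \<and> i \<le> ?m \<and> (k = 0 \<or> k = Suc ?m))" "\<not> (1 \<le> k \<and> k \<le> ?m \<and> (i = 0 \<or> i = Suc ?m))"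
      using l_in[of i] l_in[of k] l_U e(3) eq by (metis disjoint_iff)+
    with i k l_inner[of i k] eq show ?thesis by blast
  qed
  \<comment> \<open>Positions of \<open>?l\<close> can coincide only at its two ends, so an edge
    traversed both ways forces a single inner vertex with \<open>u = v\<close>, which
    \<open>ear\<close> excludes.\<close>
  have B_asym: "(y, x) \<notin> B" if xy: "(x, y) \<in> B" for x y
  proof
    assume "(y, x) \<in> B"
    then obtain k where k: "k \<le> ?m" "y = ?l ! k" "x = ?l ! Suc k" by (auto simp: B_def)
    obtain i where i: "i \<le> ?m" "x = ?l ! i" "y = ?l ! Suc i" using xy by (auto simp: B_def)
    have "i = Suc k \<or> i = 0 \<and> k = ?m" using l_inj[of i "Suc k"] i k by auto
    moreover have "k = Suc i \<or> k = 0 \<and> i = ?m" using l_inj[of k "Suc i"] i k by auto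
    ultimately have "?m = 1" "u = v \<or> ?m = 0" using i k l_v e(1) by (auto simp: nth_append)
    then show False using e by simp
  qed
  have B_fresh: "x \<in> set ps \<or> y \<in> set ps" if xy: "(x, y) \<in> B" for x y
  proof -
    obtain i where "i \<le> ?m" "x = ?l ! i" "y = ?l ! Suc i" using xy by (auto simp: B_def)
    moreover have "?l ! i \<in> set ps \<or> ?l ! Suc i \<in> set ps"
    proof (cases i)
      case 0
      then show ?thesis using l_in[of "Suc i"] e(1) by (simp add: Suc_le_eq)
    next
      case (Suc k)
      then show ?thesis using l_in[of i] \<open>i \<le> ?m\<close> by simp
    qed
    ultimately show ?thesis by metis
  qed
  have along: "(?l ! i, ?l ! k) \<in> B ^^ (k - i)" if "i \<le> k" "k \<le> Suc ?m" for i k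
    using that
  proof (induction k rule: dec_induct)
    case (step k)
    have "(?l ! k, ?l ! Suc k) \<in> B" using step by (auto simp: B_def)
    then show ?case using step by (auto simp: Suc_diff_le simp del: nth_Cons_Suc)
  qed simp
  define C where "C = A \<union> B"
  have AC: "(x, y) \<in> A ^^ k \<Longrightarrow> (x, y) \<in> C ^^ k" and BC: "(x, y) \<in> B ^^ k \<Longrightarrow> (x, y) \<in> C ^^ k" for x y k
    by (auto simp: C_def intro: relpow_mono_subset[of A] relpow_mono_subset[of B])
  have from_u: "(u, ps ! i) \<in> C ^^ Suc i" if "i < ?m" for i
    using BC[OF along[of 0 "Suc i"]] that l_nth by simp
  have to_v: "(ps ! i, v) \<in> C ^^ (?m - i)" if "i < ?m" for i
    using BC[OF along[of "Suc i" "Suc ?m"]] that l_nth l_v by simp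
  \<comment> \<open>An earlier vertex is at least one step nearer to \<open>u\<close> and at most
    one heavier than the last one, so the condition at the last vertex covers all. The same holds at
    the other end.\<close>
  have last_le: "Suc i + g (ps ! i) + b \<le> c + f u" if "i < ?m" for i
  proof (cases "Suc i = ?m")
    case True
    then have "ps ! i = last ps" using e(1) by (metis last_conv_nth diff_Suc_1)
    then show ?thesis using last True by simp
  next
    case False
    then show ?thesis using last g_ear[of "ps ! i"] g_ear[of "last ps"] that e(1) by simp
  qed
  have hd_le: "(?m - i) + g (ps ! i) + b \<le> c + f v" if "i < ?m" for i
  proof (cases "i = 0")
    case True
    then show ?thesis using hd e(1) by (simp add: hd_conv_nth)
  next
    case False
    then show ?thesis using hd g_ear[of "ps ! i"] g_ear[of "hd ps"] that e(1) by (simp, arith)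
  qed
  have "\<exists>k. (x, y) \<in> C ^^ k \<and> k + g x + g y \<le> c" if x: "x \<in> U \<union> set ps" and y: "y \<in> U \<union> set ps" for x y
  proof (cases "x \<in> U"; cases "y \<in> U")
    assume "x \<in> U" "y \<in> U"
    then obtain k where "(x, y) \<in> A ^^ k" "k + f x + f y \<le> b" using A(3) by blast
    then show ?thesis using AC g_le[OF \<open>x \<in> U\<close>] g_le[OF \<open>y \<in> U\<close>] b by (intro exI[of _ k]) auto
  next
    assume "x \<in> U" "y \<notin> U"
    then obtain i where i: "i < ?m" "y = ps ! i" using y by (auto simp: in_set_conv_nth)
    obtain k where k: "(x, u) \<in> A ^^ k" "k + f x + f u \<le> b" using A(3) e \<open>x \<in> U\<close> by blast
    have "(x, y) \<in> C ^^ (k + Suc i)" using relpow_trans[OF AC[OF k(1)] from_u[OF i(1)]] i by simp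
    then show ?thesis using last_le[OF i(1)] k(2) i(2) g_le[OF \<open>x \<in> U\<close>] by (intro exI[of _ "k + Suc i"]) auto
  next
    assume "x \<notin> U" "y \<in> U"
    then obtain i where i: "i < ?m" "x = ps ! i" using x by (auto simp: in_set_conv_nth)
    obtain k where k: "(v, y) \<in> A ^^ k" "k + f v + f y \<le> b" using A(3) e \<open>y \<in> U\<close> by blast
    have "(x, y) \<in> C ^^ (?m - i + k)" using relpow_trans[OF to_v[OF i(1)] AC[OF k(1)]] i by simp
    then show ?thesis using hd_le[OF i(1)] k(2) i(2) g_le[OF \<open>y \<in> U\<close>] by (intro exI[of _ "?m - i + k"]) auto
  next
    assume "x \<notin> U" "y \<notin> U"
    then have xy: "x \<in> set ps" "y \<in> set ps" using x y by auto
    then obtain i j where i: "i < ?m" "x = ps ! i" and j: "j < ?m" "y = ps ! j" by (auto simp: in_set_conv_nth)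
    obtain k where k: "(v, u) \<in> A ^^ k" "k + f v + f u \<le> b" using A(3) e by blast
    consider "i = j" | "i < j" | "j < i" by linarith
    then show ?thesis
    proof cases
      case 1
      have "(x, y) \<in> C ^^ 0" using 1 i j by simp
      then show ?thesis using g_ear[OF xy(1)] g_ear[OF xy(2)] b(2) by (intro exI[of _ 0]) auto
    next
      \<comment> \<open>A forward route needs only the ear: \<open>f u + f v \<le> b\<close> cancels
        the terms of \<open>U\<close> in \<open>pair\<close> and leaves room for
        \<open>length ps\<close> steps.\<close>
      case 2
      have "(x, y) \<in> C ^^ (j - i)" using BC[OF along[of "Suc i" "Suc j"]] 2 i j l_nth by simp
      moreover have "x \<noteq> y" using 2 i j e(2) by (simp add: nth_eq_iff_index_eq)
      ultimately show ?thesis using pair[OF xy] k(2) j(1) by (intro exI[of _ "j - i"]) auto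
    next
      case 3
      have "(x, y) \<in> C ^^ (?m - i + (k + Suc j))"
        using relpow_trans[OF to_v[OF i(1)] relpow_trans[OF AC[OF k(1)] from_u[OF j(1)]]] i j by simp
      moreover have "x \<noteq> y" using 3 i j e(2) by (simp add: nth_eq_iff_index_eq)
      ultimately show ?thesis using pair[OF xy] k(2) i(1) 3 by (intro exI[of _ "?m - i + (k + Suc j)"]) auto
    qed
  qed
  moreover have "C \<subseteq> E \<inter> (U \<union> set ps) \<times> (U \<union> set ps)" using A(1) B_E B_U by (auto simp: C_def)
  moreover have "(y, x) \<notin> C" if "(x, y) \<in> C" for x y
    using that A(1,2) B_asym B_fresh e(3) unfolding C_def by blast
  ultimately show ?thesis unfolding routed_def by blast
qed

text \<open>A possibly empty path outside \<open>U\<close>, without reference to end vertices. It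
  splits over append, which turns the surgeries on ears into simplification.\<close>

definition seg :: "'a set \<Rightarrow> 'a list \<Rightarrow> bool" where
  "seg U ps \<longleftrightarrow> distinct ps \<and> set ps \<inter> U = {} \<and> linked ps"
lemma seg_append: "seg U (xs @ ys) \<longleftrightarrow> seg U xs \<and> seg U ys \<and> set xs \<inter> set ys = {} \<and>
   (xs = [] \<or> ys = [] \<or> (last xs, hd ys) \<in> E)"
  unfolding seg_def by (auto simp: successively_append_iff)
lemma seg_Cons: "seg U (x # xs) \<longleftrightarrow> x \<notin> U \<and> x \<notin> set xs \<and> seg U xs \<and> (xs = [] \<or> (x, hd xs) \<in> E)"
  unfolding seg_def by (auto simp: successively_Cons)
lemma seg_Nil: "seg U []" by (simp add: seg_def)
lemma ear_seg: "ear U u ps v \<longleftrightarrow> ps \<noteq> [] \<and> seg U ps \<and> u \<in> U \<and> v \<in> U \<and> (u, hd ps) \<in> E \<and> (last ps, v) \<in> E \<and>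
  (length ps = 1 \<longrightarrow> u \<noteq> v)"
  unfolding ear_def seg_def by blast
lemma hd_append_Cons: "hd (xs @ x # ys) = (if xs = [] then x else hd xs)"
  by (cases xs) auto
lemmas ear_simps = ear_seg seg_append seg_Cons seg_Nil hd_append_Cons

subsection \<open>Short ears\<close>

lemma ear_skip: "ear U u (xs @ x # zs @ y # ys) v \<Longrightarrow> (x, y) \<in> E \<Longrightarrow> ear U u (xs @ x # y # ys) v"
  by (simp add: ear_simps Int_Un_distrib)

lemma ear_insert:
  "ear U u (xs @ x # zs @ y # ys) v \<Longrightarrow> (x, w) \<in> E \<Longrightarrow> (w, y) \<in> E \<Longrightarrow> w \<notin> U \<Longrightarrow>
    w \<notin> set (xs @ x # zs @ y # ys) \<Longrightarrow> ear U u (xs @ x # w # y # ys) v"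
  by (simp add: ear_simps Int_Un_distrib) blast

lemma ear_cut_right: "ear U u (xs @ x # ys) v \<Longrightarrow> (x, z) \<in> E \<Longrightarrow> z \<in> U \<Longrightarrow> xs \<noteq> [] \<Longrightarrow> ear U u (xs @ [x]) z"
  by (simp add: ear_simps Int_Un_distrib)

lemma ear_cut_left: "ear U u (xs @ x # ys) v \<Longrightarrow> (x, z) \<in> E \<Longrightarrow> z \<in> U \<Longrightarrow> ys \<noteq> [] \<Longrightarrow> ear U z (x # ys) v"
  by (simp add: ear_simps Int_Un_distrib E_sym)

lemma ear_divert:
  "ear U u (xs @ x # ys) v \<Longrightarrow> seg U qs \<Longrightarrow> (x, hd qs) \<in> E \<Longrightarrow> (last qs, z) \<in> E \<Longrightarrow> z \<in> U \<Longrightarrow>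
    set qs \<inter> set (xs @ x # ys) = {} \<Longrightarrow> qs \<noteq> [] \<Longrightarrow> ear U u (xs @ x # qs) z"
  by (simp add: ear_simps Int_Un_distrib) blast

lemma ear_detour:
  "ear U u (xs @ x # zs @ y # ys) v \<Longrightarrow> seg U qs \<Longrightarrow> (x, hd qs) \<in> E \<Longrightarrow> (last qs, y) \<in> E \<Longrightarrow>
    set qs \<inter> set (xs @ x # zs @ y # ys) = {} \<Longrightarrow> qs \<noteq> [] \<Longrightarrow> ear U u (xs @ x # qs @ y # ys) v"
  by (simp add: ear_simps Int_Un_distrib) blast

lemma ear_change_ends:
  "ear U u ps v \<Longrightarrow> length ps \<noteq> 1 \<Longrightarrow> (u', hd ps) \<in> E \<Longrightarrow> u' \<in> U \<Longrightarrow> (last ps, v') \<in> E \<Longrightarrow> v' \<in> U \<Longrightarrow>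
    ear U u' ps v'"
  by (auto simp: ear_def)

text \<open>\<open>C\<close> will be a set of hooks, whose weight is raised; \<open>wt {}\<close> is
  the weight without raised vertices.\<close>

definition wt :: "'a set \<Rightarrow> 'a \<Rightarrow> nat" where
  "wt C x = (if x \<in> D \<union> C then 2 else 1)"

text \<open>
  The predicate \<open>P\<close> restricts the ears under consideration; its closure properties are exactly the
  surgeries needed for the minimality argument. \<open>W\<close> collects the dominators lying off the ear, each
  of which is responsible for a single ear vertex. An end vertex of the ear that lies in \<open>D\<close> has only
  one neighbour on the ear, which is where the gain at such ends comes from.
\<close>

lemma good_ear:
  assumes K: "\<And>x y. x \<in> K \<Longrightarrow> (x, y) \<in> E \<Longrightarrow> y \<notin> U \<Longrightarrow> y \<in> K"
    and P_D: "\<And>ps. P ps \<Longrightarrow> set ps \<inter> D \<noteq> {}"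
    and P_split: "\<And>xs x ys. P (xs @ x # ys) \<Longrightarrow> P (xs @ [x]) \<or> P (x # ys)"
    and P_skip: "\<And>xs x zs y ys. P (xs @ x # zs @ y # ys) \<Longrightarrow> x \<in> D \<or> y \<in> D \<Longrightarrow> P (xs @ x # y # ys)"
    and P_insert: "\<And>xs x zs y ys w. P (xs @ x # zs @ y # ys) \<Longrightarrow> w \<in> D \<Longrightarrow> P (xs @ x # w # y # ys)"
    and P_end: "\<And>xs x ys w. P (xs @ x # ys) \<Longrightarrow> w \<in> D \<Longrightarrow> P (xs @ [x, w])"
    and ex: "ear U u0 ps0 v0" "set ps0 \<subseteq> K" "P ps0"
  obtains u ps v W where "ear U u ps v" "set ps \<subseteq> K" "P ps" "W \<subseteq> D - U - set ps"
    "\<forall>w\<in>W. \<exists>x\<in>set ps. (x, w) \<in> E" "\<forall>w\<in>W. \<forall>z\<in>U. (w, z) \<notin> E"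
    "length ps + 2 \<le> 3 * card (D \<inter> set ps) + card W +
       (if hd ps \<in> D then 0 else wt {} u) + (if last ps \<in> D then 0 else wt {} v)"
    "\<forall>u' qs v'. ear U u' qs v' \<longrightarrow> set qs \<subseteq> K \<longrightarrow> P qs \<longrightarrow>
       length (filter (\<lambda>x. x \<notin> D) ps) \<le> length (filter (\<lambda>x. x \<notin> D) qs)"
proof -
  define q where "q ps = length (filter (\<lambda>x. x \<notin> D) ps)" for ps :: "'a list"
  define d where "d ps = length (filter (\<lambda>x. x \<in> D) ps)" for ps :: "'a list"
  define cand where "cand ps \<longleftrightarrow> (\<exists>u v. ear U u ps v) \<and> set ps \<subseteq> K \<and> P ps" for ps
  \<comment> \<open>encodes the lexicographic order: first few vertices outside \<open>D\<close>, then many inside\<close>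
  define \<mu> where "\<mu> ps = q ps * Suc (card V) + (card V - d ps)" for ps
  have q_simps [simp]: "q [] = 0" "q (x # xs) = (if x \<in> D then q xs else Suc (q xs))"
    "q (xs @ ys) = q xs + q ys" for x xs ys by (auto simp: q_def)
  have d_simps [simp]: "d [] = 0" "d (x # xs) = (if x \<in> D then Suc (d xs) else d xs)"
    "d (xs @ ys) = d xs + d ys" for x xs ys by (auto simp: d_def)
  have q_pos: "0 < q xs" if "x \<in> set xs" "x \<notin> D" for x xs
    using that by (auto simp: q_def filter_empty_conv)
  have "cand ps0" using ex by (auto simp: cand_def)
  then obtain ps where ps: "cand ps" "\<forall>qs. cand qs \<longrightarrow> \<mu> ps \<le> \<mu> qs"
    using ex_has_least_nat[of cand ps0 \<mu>] by blast
  \<comment> \<open>Since an ear has distinct vertices, the subtraction in \<open>\<mu>\<close> is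
    never truncated, so equal \<open>q\<close> and larger \<open>d\<close> really give a smaller
    \<open>\<mu>\<close>.\<close>
  have d_le: "d qs \<le> card V" if qs: "cand qs" for qs
  proof -
    obtain u v where "ear U u qs v" using qs unfolding cand_def by blast
    then have "distinct qs" "set (filter (\<lambda>x. x \<in> D) qs) \<subseteq> V"
      using ear_V[of U u qs v] by (simp_all add: ear_def, blast)
    then show ?thesis unfolding d_def using card_mono[OF finite_V, of "set (filter (\<lambda>x. x \<in> D) qs)"]
        distinct_card[of "filter (\<lambda>x. x \<in> D) qs"] by simp
  qed
  have min_q: "q ps \<le> q qs" if c: "cand qs" for qs
  proof (rule ccontr)
    assume "\<not> ?thesis"
    then have "Suc (q qs) * Suc (card V) \<le> q ps * Suc (card V)" by (intro mult_right_mono) auto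
    then have "\<mu> qs < \<mu> ps" by (simp add: \<mu>_def)
    then show False using ps(2)[rule_format, OF c] by simp
  qed
  have max_d: "d qs \<le> d ps" if c: "cand qs" "q qs = q ps" for qs
    using ps(2)[rule_format, OF c(1)] c(2) d_le[OF c(1)] d_le[OF ps(1)] by (simp add: \<mu>_def)
  obtain u v where ear: "ear U u ps v" and psK: "set ps \<subseteq> K" and Pps: "P ps"
    using ps(1) by (auto simp: cand_def)
  have dist: "distinct ps" and psU: "set ps \<inter> U = {}" and ne: "ps \<noteq> []" using ear by (auto simp: ear_def)
  have psV: "set ps \<subseteq> V" using ear ear_V by blast
  let ?m = "length ps"
  \<comment> \<open>\<open>N1\<close>: next to a vertex of \<open>D\<close> on the ear; \<open>N3\<close>: otherwise, but dominated from \<open>U\<close>;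
      \<open>N2\<close>: dominated only from outside \<open>U\<close> and the ear\<close>
  define I where "I = {i. i < ?m \<and> ps ! i \<in> D}"
  define J where "J = {i. i < ?m \<and> ps ! i \<notin> D}"
  define N1 where "N1 = {i \<in> J. (Suc i < ?m \<and> ps ! Suc i \<in> D) \<or> (0 < i \<and> ps ! (i - 1) \<in> D)}"
  define N3 where "N3 = {i \<in> J - N1. \<exists>z\<in>D \<inter> U. (ps ! i, z) \<in> E}"
  define N2 where "N2 = J - N1 - N3"
  have fin: "finite I" "finite J" "finite N1" "finite N2" "finite N3"
    by (auto simp: I_def J_def N1_def N2_def N3_def)
  \<comment> \<open>A chord from such a vertex to a vertex of \<open>D\<close> on the ear would be a
    shortcut. It skips the ear neighbour of \<open>ps ! i\<close>, which is outside
    \<open>D\<close>, so \<open>q\<close> would drop.\<close>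
  have chord: "(ps ! i, ps ! l) \<notin> E" if i: "i \<in> J - N1" and l: "l < ?m" "ps ! l \<in> D" for i l
  proof
    assume e: "(ps ! i, ps ! l) \<in> E"
    have "i < ?m" "i \<noteq> l" using i l by (auto simp: J_def)
    then consider "i < l" | "l < i" by linarith
    then show False
    proof cases
      case 1
      obtain xs zs ys where s: "ps = xs @ ps ! i # zs @ ps ! l # ys"
        "zs = [] \<longleftrightarrow> l = Suc i" "zs \<noteq> [] \<Longrightarrow> hd zs = ps ! Suc i"
        by (rule split_list_two[OF 1 l(1)]) blast
      let ?qs = "xs @ ps ! i # ps ! l # ys"
      have "zs \<noteq> []" "ps ! Suc i \<notin> D" using s(2) i l 1 by (auto simp: N1_def)
      then have "0 < q zs" using s(3) q_pos[OF hd_in_set] by metis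
      then have "q ?qs < q ps" using arg_cong[OF s(1), of q] by simp
      moreover have "cand ?qs"
      proof -
        have "ear U u (xs @ ps ! i # zs @ ps ! l # ys) v" "P (xs @ ps ! i # zs @ ps ! l # ys)"
          "set (xs @ ps ! i # zs @ ps ! l # ys) \<subseteq> K"
          using ear Pps psK by (simp_all only: s(1)[symmetric])
        then have "ear U u ?qs v" "P ?qs" "set ?qs \<subseteq> K"
          using ear_skip e P_skip l by (blast, blast, auto)
        then show ?thesis unfolding cand_def by blast
      qed
      ultimately show False using min_q[of ?qs] by simp
    next
      case 2
      obtain xs zs ys where s: "ps = xs @ ps ! l # zs @ ps ! i # ys"
        "zs = [] \<longleftrightarrow> i = Suc l" "zs \<noteq> [] \<Longrightarrow> last zs = ps ! (i - 1)"
        by (rule split_list_two[OF 2 \<open>i < ?m\<close>]) blast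
      let ?qs = "xs @ ps ! l # ps ! i # ys"
      have "zs \<noteq> []" "ps ! (i - 1) \<notin> D" using s(2) i l 2 by (auto simp: N1_def)
      then have "0 < q zs" using s(3) q_pos[OF last_in_set] by metis
      then have "q ?qs < q ps" using arg_cong[OF s(1), of q] by simp
      moreover have "cand ?qs"
      proof -
        have "ear U u (xs @ ps ! l # zs @ ps ! i # ys) v" "P (xs @ ps ! l # zs @ ps ! i # ys)"
          "set (xs @ ps ! l # zs @ ps ! i # ys) \<subseteq> K"
          using ear Pps psK by (simp_all only: s(1)[symmetric])
        then have "ear U u ?qs v" "P ?qs" "set ?qs \<subseteq> K"
          using ear_skip E_sym[OF e] P_skip l by (blast, blast, auto)
        then show ?thesis unfolding cand_def by blast
      qed
      ultimately show False using min_q[of ?qs] by simp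
    qed
  qed
  \<comment> \<open>At an inner vertex of \<open>N3\<close> the ear can be cut towards
    \<open>U\<close>. Both halves lose a neighbour outside \<open>D\<close>, and
    \<open>P_split\<close> keeps one of them a candidate with smaller \<open>q\<close>.\<close>
  have N3_ends: "i = 0 \<or> i = ?m - 1" if iN: "i \<in> N3" for i
  proof (rule ccontr)
    assume "\<not> ?thesis"
    then have i: "0 < i" "Suc i < ?m" and iJ: "i \<in> J - N1" using that by (auto simp: N3_def J_def)
    obtain z where z: "z \<in> U" "(ps ! i, z) \<in> E" using iN by (auto simp: N3_def)
    let ?xs = "take i ps" and ?ys = "drop (Suc i) ps"
    have s: "ps = ?xs @ ps ! i # ?ys" using i by (simp add: id_take_nth_drop)
    have ne2: "?xs \<noteq> []" "?ys \<noteq> []" using i by auto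
    have "ps ! (i - 1) \<in> set ?xs" "ps ! Suc i \<in> set ?ys"
      using i by (simp_all add: nth_in_set_take nth_in_set_drop)
    moreover have "ps ! (i - 1) \<notin> D" "ps ! Suc i \<notin> D" using iJ i by (auto simp: N1_def)
    ultimately have "0 < q ?xs" "0 < q ?ys" using q_pos by blast+
    moreover have "q ps = q ?xs + q (ps ! i # ?ys)" "q ps = q (?xs @ [ps ! i]) + q ?ys"
      using arg_cong[OF s, of q] by simp_all
    ultimately have lt: "q (?xs @ [ps ! i]) < q ps" "q (ps ! i # ?ys) < q ps" by linarith+
    have "set (?xs @ [ps ! i]) \<subseteq> K" "set (ps ! i # ?ys) \<subseteq> K"
      using psK i by (auto dest: in_set_takeD in_set_dropD)
    moreover have s_ear: "ear U u (?xs @ ps ! i # ?ys) v" and s_P: "P (?xs @ ps ! i # ?ys)"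
      using ear Pps by (simp_all only: s[symmetric])
    moreover have "ear U u (?xs @ [ps ! i]) z" "ear U z (ps ! i # ?ys) v"
      by (rule ear_cut_right[OF s_ear z(2,1) ne2(1)], rule ear_cut_left[OF s_ear z(2,1) ne2(2)])
    moreover have "P (?xs @ [ps ! i]) \<or> P (ps ! i # ?ys)" using P_split[OF s_P] .
    ultimately have "cand (?xs @ [ps ! i]) \<or> cand (ps ! i # ?ys)" unfolding cand_def by blast
    then show False using min_q[of "?xs @ [ps ! i]"] min_q[of "ps ! i # ?ys"] lt by linarith
  qed
  have dom: "\<exists>w. w \<in> D \<and> (ps ! i, w) \<in> E \<and> w \<notin> U \<and> w \<notin> set ps" if "i \<in> N2" for i
  proof -
    have i: "i \<in> J - N1" "i \<notin> N3" using that by (auto simp: N2_def)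
    then have "ps ! i \<in> V - D" using psV nth_mem by (fastforce simp: J_def)
    then obtain w where w: "w \<in> D" "(ps ! i, w) \<in> E" using dominated by blast
    moreover have "w \<notin> U" using w i by (auto simp: N3_def)
    moreover have "w \<notin> set ps" using w chord[OF i(1)] by (auto simp: in_set_conv_nth)
    ultimately show ?thesis by blast
  qed
  then obtain w where w: "\<And>i. i \<in> N2 \<Longrightarrow> w i \<in> D" "\<And>i. i \<in> N2 \<Longrightarrow> (ps ! i, w i) \<in> E"
    "\<And>i. i \<in> N2 \<Longrightarrow> w i \<notin> U" "\<And>i. i \<in> N2 \<Longrightarrow> w i \<notin> set ps" by metis
  have wK: "w i \<in> K" if "i \<in> N2" for i
  proof -
    have "i < ?m" using that by (simp add: N2_def J_def)
    then have "ps ! i \<in> K" using psK nth_mem by blast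
    then show ?thesis using K w(2,3)[OF that] by blast
  qed
  \<comment> \<open>Otherwise the ear could be diverted at \<open>ps ! i\<close> through
    \<open>w i\<close> into \<open>U\<close>. If a part is cut off, it starts outside
    \<open>D\<close> and \<open>q\<close> drops; if \<open>ps ! i\<close> is already the last
    vertex, \<open>q\<close> is unchanged and \<open>d\<close> grows. This is one of the two uses of
    the second criterion.\<close>
  have w_far: "(w i, z) \<notin> E" if i: "i \<in> N2" and z: "z \<in> U" for i z
  proof
    assume e: "(w i, z) \<in> E"
    have iJ: "i \<in> J - N1" "i < ?m" using i by (auto simp: N2_def J_def)
    let ?xs = "take i ps" and ?ys = "drop (Suc i) ps"
    have s: "ps = ?xs @ ps ! i # ?ys" using iJ by (simp add: id_take_nth_drop)
    have "ear U u (?xs @ ps ! i # [w i]) z"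
    proof (rule ear_divert)
      show "ear U u (?xs @ ps ! i # ?ys) v" using ear by (simp only: s[symmetric])
      show "set [w i] \<inter> set (?xs @ ps ! i # ?ys) = {}"
        using w(4)[OF i] by (simp only: s[symmetric]) simp
      show "seg U [w i]" using w(3)[OF i] by (simp add: seg_def)
    qed (use e z w(2)[OF i] in simp_all)
    moreover have "P (?xs @ [ps ! i, w i])"
      by (rule P_end[of _ _ ?ys]) (use Pps w(1)[OF i] in \<open>simp_all only: s[symmetric]\<close>)
    moreover have "set (?xs @ [ps ! i, w i]) \<subseteq> K"
      using psK iJ wK[OF i] by (auto dest: in_set_takeD)
    ultimately have c: "cand (?xs @ [ps ! i, w i])" unfolding cand_def by auto
    have qd: "q ps = q (?xs @ [ps ! i]) + q ?ys" "d ps = d (?xs @ [ps ! i]) + d ?ys"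
      using arg_cong[OF s, of q] arg_cong[OF s, of d] by simp_all
    show False
    proof (cases "Suc i < ?m")
      case True
      then have "ps ! Suc i \<in> set ?ys" "ps ! Suc i \<notin> D"
        using iJ by (simp add: nth_in_set_drop, auto simp: N1_def)
      then have "0 < q ?ys" using q_pos by blast
      then show False using min_q[OF c] qd w(1)[OF i] by (auto split: if_splits)
    next
      case False
      then have "?ys = []" by simp
      then show False using max_d[OF c] qd w(1)[OF i] by (auto split: if_splits)
    qed
  qed
  \<comment> \<open>A common dominator of two vertices could be inserted between them: either a
    skipped vertex outside \<open>D\<close> lowers \<open>q\<close>, or the two are adjacent on the
    ear and \<open>d\<close> grows.\<close>
  have w_inj: "inj_on w N2"
  proof (rule linorder_inj_onI)
    fix i l assume il: "i < l" "i \<in> N2" "l \<in> N2"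
    show "w i \<noteq> w l"
    proof
      assume eq: "w i = w l"
      have iJ: "i \<in> J - N1" "l < ?m" using il by (auto simp: N2_def J_def)
      obtain xs zs ys where s: "ps = xs @ ps ! i # zs @ ps ! l # ys"
        "zs = [] \<longleftrightarrow> l = Suc i" "zs \<noteq> [] \<Longrightarrow> hd zs = ps ! Suc i"
        by (rule split_list_two[OF il(1) iJ(2)]) blast
      let ?qs = "xs @ ps ! i # w i # ps ! l # ys"
      have "ear U u ?qs v"
      proof (rule ear_insert)
        show "ear U u (xs @ ps ! i # zs @ ps ! l # ys) v" using ear by (simp only: s(1)[symmetric])
        show "w i \<notin> set (xs @ ps ! i # zs @ ps ! l # ys)" using w(4)[OF il(2)] by (simp only: s(1)[symmetric]) simp
      qed (use w[OF il(2)] w(2)[OF il(3)] E_sym eq in auto)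
      moreover have "P ?qs"
        by (rule P_insert[of _ _ zs]) (use Pps w(1)[OF il(2)] in \<open>simp_all only: s(1)[symmetric]\<close>)
      moreover have "set ?qs \<subseteq> K"
      proof -
        have "set (xs @ ps ! i # zs @ ps ! l # ys) \<subseteq> K" using psK by (simp only: s(1)[symmetric])
        then show ?thesis using wK[OF il(2)] by auto
      qed
      ultimately have c: "cand ?qs" unfolding cand_def by blast
      have qd: "q ps = q (xs @ ps ! i # ps ! l # ys) + q zs" "d ps = d (xs @ ps ! i # ps ! l # ys) + d zs"
        using arg_cong[OF s(1), of q] arg_cong[OF s(1), of d] by simp_all
      show False
      proof (cases "zs = []")
        case True
        then show False using max_d[OF c] qd w(1)[OF il(2)] by (auto split: if_splits)
      next
        case False
        then have "ps ! Suc i \<in> set zs" "ps ! Suc i \<notin> D"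
          using s(3) iJ il(1) by (metis hd_in_set, auto simp: N1_def)
        then have "0 < q zs" using q_pos by blast
        then show False using min_q[OF c] qd w(1)[OF il(2)] by (auto split: if_splits)
      qed
    qed
  qed auto
  have I_len: "card I = length (filter (\<lambda>x. x \<in> D) ps)"
    unfolding I_def by (rule length_filter_conv_card[symmetric])
  have J_len: "card J = length (filter (\<lambda>x. x \<notin> D) ps)"
    unfolding J_def by (rule length_filter_conv_card[symmetric])
  have I_card: "card I = card (D \<inter> set ps)"
    unfolding I_len distinct_length_filter[OF dist] by simp
  have m_card: "?m = card I + card J"
    unfolding I_len J_len by (rule sum_length_filter_compl[symmetric])
  have hd_I: "0 \<in> I \<longleftrightarrow> hd ps \<in> D" and last_I: "?m - 1 \<in> I \<longleftrightarrow> last ps \<in> D"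
    using ne by (auto simp: I_def hd_conv_nth last_conv_nth)
  \<comment> \<open>Each vertex of \<open>D\<close> on the ear accounts for at most two vertices of
    \<open>N1\<close>, but the first and the last position have a neighbour on one side
    only.\<close>
  have "N1 \<subseteq> (\<lambda>i. i - 1) ` (I - {0}) \<union> Suc ` (I - {?m - 1})"
  proof
    fix i assume "i \<in> N1"
    then have "Suc i \<in> I \<or> 0 < i \<and> i - 1 \<in> I" "i < ?m" by (auto simp: N1_def I_def J_def)
    then consider "Suc i \<in> I - {0}" | "0 < i" "i - 1 \<in> I - {?m - 1}" by fastforce
    then show "i \<in> (\<lambda>i. i - 1) ` (I - {0}) \<union> Suc ` (I - {?m - 1})"
    proof cases
      case 1
      then have "Suc i - 1 \<in> (\<lambda>i. i - 1) ` (I - {0})" by (rule imageI)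
      then show ?thesis by simp
    next
      case 2
      then have "Suc (i - 1) \<in> Suc ` (I - {?m - 1})" by (intro imageI)
      then show ?thesis using 2(1) by simp
    qed
  qed
  then have "card N1 \<le> card ((\<lambda>i. i - 1) ` (I - {0}) \<union> Suc ` (I - {?m - 1}))"
    using fin by (intro card_mono) auto
  also have "\<dots> \<le> card (I - {0}) + card (I - {?m - 1})"
    using fin(1) by (intro order_trans[OF card_Un_le] add_mono card_image_le) auto
  finally have N1_card: "card N1 + (if hd ps \<in> D then 1 else 0) + (if last ps \<in> D then 1 else 0) \<le> 2 * card I"
  proof -
    assume *: "card N1 \<le> card (I - {0}) + card (I - {?m - 1})"
    have "card (I - {x}) + (if x \<in> I then 1 else 0) = card I" for x
      using card.remove[OF fin(1), of x] by (cases "x \<in> I") simp_all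
    from this[of 0] this[of "?m - 1"] * show ?thesis
      unfolding hd_I last_I by (cases "hd ps \<in> D"; cases "last ps \<in> D") simp_all
  qed
  have J_card: "card J \<le> card N1 + card N2 + card N3"
  proof -
    have "J \<subseteq> N1 \<union> N2 \<union> N3" by (auto simp: N2_def)
    then have "card J \<le> card (N1 \<union> N2 \<union> N3)" using fin by (intro card_mono) auto
    then show ?thesis using card_Un_le[of "N1 \<union> N2" N3] card_Un_le[of N1 N2] by linarith
  qed
  have N3_card: "card N3 \<le> (if 0 \<in> N3 then 1 else 0) + (if ?m - 1 \<in> N3 then 1 else 0)"
  proof -
    have "N3 \<subseteq> (N3 \<inter> {0}) \<union> (N3 \<inter> {?m - 1})" using N3_ends by auto
    then have "card N3 \<le> card ((N3 \<inter> {0}) \<union> (N3 \<inter> {?m - 1}))" by (intro card_mono) auto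
    also have "\<dots> \<le> card (N3 \<inter> {0}) + card (N3 \<inter> {?m - 1})" by (rule card_Un_le)
    finally show ?thesis by (auto simp: Int_insert_right split: if_splits)
  qed
  \<comment> \<open>With one inner vertex the ends must not be exchanged, since they could become
    equal. This case is harmless because \<open>P\<close> forces that vertex into
    \<open>D\<close>.\<close>
  have m1: "N3 = {}" if "?m = 1"
  proof -
    obtain x where "ps = [x]" using \<open>?m = 1\<close> by (auto simp: length_Suc_conv)
    then show ?thesis using P_D[OF Pps] by (auto simp: N3_def J_def)
  qed
  have N3_z: "\<exists>z. z \<in> D \<and> z \<in> U \<and> (ps ! i, z) \<in> E" if "i \<in> N3" for i using that by (auto simp: N3_def)
  \<comment> \<open>An end vertex of the ear in \<open>N3\<close> is attached to its dominator in
    \<open>U\<close> instead of the old end; the weight 2 of the new end pays for that ear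
    vertex.\<close>
  define u' where "u' = (if 0 \<in> N3 then SOME z. z \<in> D \<and> z \<in> U \<and> (ps ! 0, z) \<in> E else u)"
  define v' where "v' = (if ?m - 1 \<in> N3 then SOME z. z \<in> D \<and> z \<in> U \<and> (ps ! (?m - 1), z) \<in> E else v)"
  have u'3: "u' \<in> D \<and> u' \<in> U \<and> (ps ! 0, u') \<in> E" if "0 \<in> N3"
    using someI_ex[OF N3_z[OF that]] that by (simp add: u'_def)
  have v'3: "v' \<in> D \<and> v' \<in> U \<and> (ps ! (?m - 1), v') \<in> E" if "?m - 1 \<in> N3"
    using someI_ex[OF N3_z[OF that]] that by (simp add: v'_def)
  have ear': "ear U u' ps v'"
  proof (cases "?m = 1")
    case True
    then show ?thesis using m1 ear by (simp add: u'_def v'_def)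
  next
    case False
    have u: "(u', hd ps) \<in> E \<and> u' \<in> U"
      using u'3 ear ne E_sym by (cases "0 \<in> N3") (auto simp: hd_conv_nth u'_def ear_def)
    have v: "(last ps, v') \<in> E \<and> v' \<in> U"
      using v'3 ear ne by (cases "?m - 1 \<in> N3") (auto simp: last_conv_nth v'_def ear_def)
    show ?thesis using ear_change_ends[OF ear False] u v by blast
  qed
  have u_wt: "(if 0 \<in> N3 then 2 else 1) \<le> (if hd ps \<in> D then 1 else wt {} u')"
    using u'3 hd_I unfolding wt_def by (auto simp: N3_def J_def I_def)
  have v_wt: "(if ?m - 1 \<in> N3 then 2 else 1) \<le> (if last ps \<in> D then 1 else wt {} v')"
    using v'3 last_I unfolding wt_def by (auto simp: N3_def J_def I_def)
  have W_card: "card (w ` N2) = card N2" using w_inj by (rule card_image)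
  show thesis
  proof (rule that[OF ear' psK Pps, of "w ` N2"])
    show "w ` N2 \<subseteq> D - U - set ps" using w by auto
    show "\<forall>y\<in>w ` N2. \<exists>x\<in>set ps. (x, y) \<in> E"
      using w(2) by (auto simp: N2_def J_def intro!: bexI[of _ "ps ! _"])
    show "\<forall>y\<in>w ` N2. \<forall>z\<in>U. (y, z) \<notin> E" using w_far by auto
    show "?m + 2 \<le> 3 * card (D \<inter> set ps) + card (w ` N2) +
       (if hd ps \<in> D then 0 else wt {} u') + (if last ps \<in> D then 0 else wt {} v')"
      using m_card J_card N1_card N3_card u_wt v_wt I_card W_card by (auto split: if_splits)
    show "\<forall>u' qs v'. ear U u' qs v' \<longrightarrow> set qs \<subseteq> K \<longrightarrow> P qs \<longrightarrow>
       length (filter (\<lambda>x. x \<notin> D) ps) \<le> length (filter (\<lambda>x. x \<notin> D) qs)"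
      using min_q unfolding cand_def q_def by blast
  qed
qed

subsection \<open>Hooks and the growth of the oriented subgraph\<close>

lemma comp_in_closed:
  assumes "\<And>x y. x \<in> K \<Longrightarrow> (x, y) \<in> E \<Longrightarrow> y \<notin> U \<Longrightarrow> y \<in> K" "U \<subseteq> U'" "p \<in> K"
  shows "comp U' p \<subseteq> K"
proof
  fix w assume "w \<in> comp U' p"
  then have "(p, w) \<in> (outside U')\<^sup>*" by (simp add: comp_def)
  then show "w \<in> K"
  proof (induction rule: rtrancl_induct)
    case (step y z)
    then show ?case using assms(1)[of y z] assms(2) by (auto simp: outside_def)
  qed (rule assms(3))
qed

text \<open>The new ear leaves the old one at \<open>x\<close>, runs through \<open>p\<close> to
  \<open>z\<close>, and then either ends in \<open>U\<close> or rejoins the old ear behind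
  \<open>x\<close>. Rejoining before \<open>x\<close> is later reduced to this case by reversing the
  ear.\<close>

lemma ear_via_branch_right:
  assumes ear: "ear U u (xs @ x # ys) v" and p: "(x, p) \<in> E" "p \<notin> U \<union> set (xs @ x # ys)"
    and z: "z \<in> comp (U \<union> set (xs @ x # ys)) p" and w: "(z, w) \<in> E" "w \<in> U \<union> set ys"
  shows "\<exists>v' qs. ear U u qs v' \<and> set qs \<subseteq> set (xs @ x # ys) \<union> comp (U \<union> set (xs @ x # ys)) p \<and> p \<in> set qs"
proof -
  let ?U = "U \<union> set (xs @ x # ys)"
  obtain rs where rs: "rs \<noteq> []" "hd rs = p" "last rs = z" "distinct rs" "linked rs"
    "set rs \<subseteq> comp ?U p" "set rs \<inter> ?U = {}" by (rule comp_path[OF p(2) z]) blast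
  have seg: "seg U rs" "set rs \<inter> set (xs @ x # ys) = {}" using rs by (auto simp: seg_def)
  have "p \<in> set rs" using rs(1,2) hd_in_set by metis
  show ?thesis
  proof (cases "w \<in> U")
    case True
    then have "ear U u (xs @ x # rs) w" using ear_divert[OF ear seg(1)] seg(2) rs(1-3) p(1) w(1) by simp
    then show ?thesis using rs(6) \<open>p \<in> set rs\<close>
      by (intro exI[of _ w] exI[of _ "xs @ x # rs"]) auto
  next
    case False
    then obtain as bs where ys: "ys = as @ w # bs" using w(2) by (meson UnE split_list)
    have "ear U u (xs @ x # rs @ w # bs) v"
      using ear_detour[OF ear[unfolded ys] seg(1)] seg(2)[unfolded ys] rs(1-3) p(1) w(1) by simp
    then show ?thesis using rs(6) \<open>p \<in> set rs\<close>
      by (intro exI[of _ v] exI[of _ "xs @ x # rs @ w # bs"]) (auto simp: ys)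
  qed
qed

lemma ear_via_branch:
  assumes ear: "ear U u ps v" and p: "x \<in> set ps" "(x, p) \<in> E" "p \<notin> U \<union> set ps"
    and z: "z \<in> comp (U \<union> set ps) p" and w: "(z, w) \<in> E" "w \<in> U \<union> set ps" "w \<noteq> x"
  shows "\<exists>u' qs v'. ear U u' qs v' \<and> set qs \<subseteq> set ps \<union> comp (U \<union> set ps) p \<and> p \<in> set qs"
proof -
  obtain xs ys where s: "ps = xs @ x # ys" using p(1) by (meson split_list)
  consider "w \<in> U \<union> set ys" | "w \<in> set xs" using w s by auto
  then show ?thesis
  proof cases
    case 1
    then show ?thesis using ear_via_branch_right[of U u xs x ys v p z w] ear p z w unfolding s by blast
  next
    case 2
    have r: "rev ps = rev ys @ x # rev xs" "set (rev ys @ x # rev xs) = set ps" using s by auto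
    have "\<exists>v' qs. ear U v qs v' \<and> set qs \<subseteq> set (rev ys @ x # rev xs) \<union> comp (U \<union> set (rev ys @ x # rev xs)) p \<and> p \<in> set qs"
    proof (rule ear_via_branch_right[where u = v and v = u and z = z and w = w])
      show "ear U v (rev ys @ x # rev xs) u" using ear_rev[OF ear] r(1) by simp
    qed (use p z w 2 in \<open>simp_all only: r(2), simp_all\<close>)
    then show ?thesis unfolding r(2) by blast
  qed
qed

text \<open>
  A hook is the only vertex of \<open>U\<close> through which some component of the rest containing a vertex
  of \<open>D\<close> can be reached.
\<close>

definition hook :: "'a set \<Rightarrow> 'a \<Rightarrow> bool" where
  "hook U c \<longleftrightarrow> c \<in> U - D \<and> (\<exists>y\<in>D - U. \<forall>z\<in>comp U y. \<forall>v\<in>U. (z, v) \<in> E \<longrightarrow> v = c)"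

text \<open>If the component of \<open>p\<close> beyond the enlarged set had an edge to a vertex
  other than \<open>x\<close>, the ear could be rerouted through \<open>p\<close> inside
  \<open>K\<close>, against \<open>no_ear\<close>.\<close>

lemma hook_of_branch:
  assumes ear: "ear U u ps v" "set ps \<subseteq> K"
    and K: "\<And>x y. x \<in> K \<Longrightarrow> (x, y) \<in> E \<Longrightarrow> y \<notin> U \<Longrightarrow> y \<in> K"
    and no_ear: "\<And>u qs v. ear U u qs v \<Longrightarrow> set qs \<subseteq> K \<Longrightarrow> p \<notin> set qs"
    and x: "x \<in> set ps" "x \<notin> D" "(x, p) \<in> E" "p \<notin> U"
    and y: "y \<in> D" "y \<in> comp (U \<union> set ps) p"
  shows "hook (U \<union> set ps) x"
proof -
  let ?U = "U \<union> set ps"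
  have p: "p \<notin> ?U" using no_ear[OF ear] x by auto
  have "p \<in> K" using K x ear(2) by blast
  then have sub: "comp ?U p \<subseteq> K" by (intro comp_in_closed[OF K]) auto
  have "w = x" if zw: "z \<in> comp ?U p" "w \<in> ?U" "(z, w) \<in> E" for z w
  proof (rule ccontr)
    assume "w \<noteq> x"
    then obtain u' qs v' where "ear U u' qs v'" "set qs \<subseteq> set ps \<union> comp ?U p" "p \<in> set qs"
      using ear_via_branch[OF ear(1) x(1,3) p zw(1,3,2)] by blast
    then show False using no_ear[of u' qs v'] sub ear(2) by blast
  qed
  moreover have "comp ?U y = comp ?U p" using comp_eq[OF y(2)] .
  moreover have "y \<notin> ?U" using comp_outside[OF p y(2)] .
  ultimately show ?thesis unfolding hook_def using x y by blast
qed

text \<open>A component attached to \<open>U\<close> at one vertex determines that vertex, since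
  connectedness provides at least one edge to \<open>U\<close>. So \<open>c' \<noteq> c\<close>
  makes the component behind \<open>c'\<close> disjoint from \<open>comp U y\<close>, and adding
  \<open>S\<close> does not touch it.\<close>

lemma hook_preserved:
  assumes hook: "hook U c'" and U: "U \<subseteq> V" and y: "y \<in> V" "y \<notin> U"
    and only: "\<And>z v. z \<in> comp U y \<Longrightarrow> v \<in> U \<Longrightarrow> (z, v) \<in> E \<Longrightarrow> v = c"
    and S: "S \<subseteq> comp U y" and "c' \<noteq> c"
  shows "hook (U \<union> S) c'"
proof -
  obtain y' where y': "y' \<in> D - U" "\<And>z v. z \<in> comp U y' \<Longrightarrow> v \<in> U \<Longrightarrow> (z, v) \<in> E \<Longrightarrow> v = c'"
    and c': "c' \<in> U - D" using hook by (auto simp: hook_def)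
  have disj: "comp U y \<inter> comp U y' = {}"
  proof (rule ccontr)
    assume "comp U y \<inter> comp U y' \<noteq> {}"
    then have eq: "comp U y = comp U y'" using comp_eq by blast
    obtain w v where "w \<in> comp U y" "v \<in> U" "(w, v) \<in> E" using comp_attached[OF y U] c' by blast
    then show False using only y'(2) eq \<open>c' \<noteq> c\<close> by blast
  qed
  have "y' \<notin> S" using disj S comp_self by blast
  moreover have "v = c'" if z: "z \<in> comp (U \<union> S) y'" "v \<in> U \<union> S" "(z, v) \<in> E" for z v
  proof (cases "v \<in> U")
    case True
    then show ?thesis using y'(2) z comp_mono[of U "U \<union> S"] by blast
  next
    case False
    then have "v \<in> comp U y'" using comp_closed[of y' U z v] comp_mono[of U "U \<union> S" y'] z y' by blast
    then show ?thesis using disj S z False by blast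
  qed
  ultimately show ?thesis unfolding hook_def using y' c' by blast
qed

text \<open>
  The potential lends two units for each hook in \<open>C\<close> and one unit for each vertex of \<open>T\<close>; both are
  repaid when the corresponding vertices of \<open>D\<close> join \<open>U\<close>. Membership in \<open>T\<close> is pure
  bookkeeping: not every vertex of \<open>D - U\<close> adjacent to \<open>U\<close> has to be in \<open>T\<close>.
\<close>

definition state :: "'a set \<Rightarrow> 'a set \<Rightarrow> 'a set \<Rightarrow> bool" where
  "state U C T \<longleftrightarrow> U \<subseteq> V \<and> D \<inter> U \<noteq> {} \<and> (\<forall>c\<in>C. hook U c) \<and> T \<subseteq> D - U \<and>
     (\<forall>y\<in>T. \<exists>u\<in>U - C. (u, y) \<in> E) \<and>
     routed U (wt C) (4 * card (D \<inter> U) + 2 * card C + card T)"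

lemma state_finite:
  assumes "state U C T"
  shows "finite U" "finite C" "finite T"
proof -
  have "U \<subseteq> V" "C \<subseteq> V" "T \<subseteq> V" using assms D_subset by (auto simp: state_def hook_def)
  then show "finite U" "finite C" "finite T" using finite_V finite_subset by blast+
qed

text \<open>The share \<open>4 * card (D \<inter> U)\<close> cancels in \<open>ear_extend\<close>;
  \<open>R\<close>, \<open>last\<close>, \<open>hd\<close> and \<open>pair\<close> are what remains.
  No old vertex may gain weight, so by \<open>CU\<close> every new hook lies on the ear.\<close>

lemma state_extend:
  assumes st: "state U C T" and ear: "ear U u ps v"
    and hooks: "\<And>c. c \<in> C' \<Longrightarrow> hook (U \<union> set ps) c" and CU: "C' \<inter> U \<subseteq> C"
    and T: "T' \<subseteq> D - U - set ps" "\<And>y. y \<in> T' \<Longrightarrow> \<exists>x\<in>U \<union> set ps - C'. (x, y) \<in> E"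
    and R: "2 * card C + card T \<le> 4 * card (D \<inter> set ps) + 2 * card C' + card T'"
    and last: "length ps + wt C' (last ps) + 2 * card C + card T
      \<le> 4 * card (D \<inter> set ps) + 2 * card C' + card T' + wt C u"
    and hd: "length ps + wt C' (hd ps) + 2 * card C + card T
      \<le> 4 * card (D \<inter> set ps) + 2 * card C' + card T' + wt C v"
    and pair: "\<And>x y. x \<in> set ps \<Longrightarrow> y \<in> set ps \<Longrightarrow> x \<noteq> y \<Longrightarrow>
      length ps + wt C' x + wt C' y + 2 * card C + card T
      \<le> 4 * card (D \<inter> set ps) + 2 * card C' + card T' + wt C u + wt C v"
  shows "\<exists>U' C' T'. state U' C' T' \<and> U \<subset> U'"
proof -
  have fin: "finite (D \<inter> U)" using finite_subset[OF D_subset finite_V] by simp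
  have e: "set ps \<inter> U = {}" "ps \<noteq> []" using ear by (auto simp: ear_def)
  have psV: "set ps \<subseteq> V" using ear by (rule ear_V)
  have s: "U \<subseteq> V" "D \<inter> U \<noteq> {}" "routed U (wt C) (4 * card (D \<inter> U) + 2 * card C + card T)"
    using st by (auto simp: state_def)
  have "card (D \<inter> (U \<union> set ps)) = card (D \<inter> U) + card (D \<inter> set ps)"
    unfolding Int_Un_distrib using fin e(1) by (intro card_Un_disjoint) auto
  then have c: "4 * card (D \<inter> (U \<union> set ps)) + 2 * card C' + card T' =
    4 * card (D \<inter> U) + (4 * card (D \<inter> set ps) + 2 * card C' + card T')" by simp
  have "1 \<le> card (D \<inter> U)" using s(2) fin by (simp add: Suc_le_eq card_gt_0_iff)
  have "routed (U \<union> set ps) (wt C') (4 * card (D \<inter> (U \<union> set ps)) + 2 * card C' + card T')"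
    unfolding c
  proof (rule ear_extend[OF s(3) ear])
    show "wt C' x \<le> wt C x" if "x \<in> U" for x using that CU by (auto simp: wt_def)
    show "1 \<le> wt C' x \<and> wt C' x \<le> 2" for x by (auto simp: wt_def)
    show "4 \<le> 4 * card (D \<inter> U) + (4 * card (D \<inter> set ps) + 2 * card C' + card T')"
      using \<open>1 \<le> card (D \<inter> U)\<close> by simp
    show "length ps + wt C' x + wt C' y + (4 * card (D \<inter> U) + 2 * card C + card T)
      \<le> 4 * card (D \<inter> U) + (4 * card (D \<inter> set ps) + 2 * card C' + card T') + wt C u + wt C v"
      if "x \<in> set ps" "y \<in> set ps" "x \<noteq> y" for x y using pair[OF that] by simp
  qed (use R last hd in simp_all)
  then have "state (U \<union> set ps) C' T'" unfolding state_def using s psV hooks T by auto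
  then show ?thesis using e by (intro exI[of _ "U \<union> set ps"] exI[of _ C'] exI[of _ T']) (auto simp: neq_Nil_conv)
qed

section \<open>Growth steps, one for each kind of ear that is available\<close>

lemma wt_add_le:
  assumes "x \<in> set ps" "y \<in> set ps" "x \<noteq> y" "C \<inter> set ps = {}"
  shows "wt C x + wt C y \<le> 2 + card (D \<inter> set ps) \<and> wt C x + wt C y \<le> 4"
proof -
  have wt: "wt C x = (if x \<in> D then 2 else 1)" "wt C y = (if y \<in> D then 2 else 1)"
    using assms(1,2,4) by (auto simp: wt_def)
  have "card (D \<inter> {x, y}) \<le> card (D \<inter> set ps)" using assms(1,2) by (intro card_mono) auto
  then show ?thesis unfolding wt using assms(3) by (cases "x \<in> D"; cases "y \<in> D") simp_all
qed

lemma card_D_pos: "set ps \<inter> D \<noteq> {} \<Longrightarrow> 1 \<le> card (D \<inter> set ps)"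
  using card_gt_0_iff[of "D \<inter> set ps"] by auto

lemma good_ear_with_D:
  assumes K: "\<And>x y. x \<in> K \<Longrightarrow> (x, y) \<in> E \<Longrightarrow> y \<notin> U \<Longrightarrow> y \<in> K"
    and ex: "ear U u0 ps0 v0" "set ps0 \<subseteq> K" "set ps0 \<inter> D \<noteq> {}"
  obtains u ps v W where "ear U u ps v" "set ps \<subseteq> K" "1 \<le> card (D \<inter> set ps)" "W \<subseteq> D - U - set ps"
    "\<forall>w\<in>W. \<exists>x\<in>set ps. (x, w) \<in> E" "\<forall>w\<in>W. \<forall>z\<in>U. (w, z) \<notin> E"
    "length ps + 2 \<le> 3 * card (D \<inter> set ps) + card W +
       (if hd ps \<in> D then 0 else wt {} u) + (if last ps \<in> D then 0 else wt {} v)"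
proof -
  let ?P = "\<lambda>ps. set ps \<inter> D \<noteq> {}"
  show thesis
  proof (rule good_ear[of K U ?P u0 ps0 v0])
    show "z \<in> K" if "x \<in> K" "(x, z) \<in> E" "z \<notin> U" for x z using K that .
    show "?P (xs @ [x]) \<or> ?P (x # ys)" if "?P (xs @ x # ys)" for xs x ys using that by auto
    show "?P (xs @ x # y # ys)" if "x \<in> D \<or> y \<in> D" for xs x y ys using that by auto
    show "?P (xs @ x # w # y # ys)" if "w \<in> D" for xs x y ys w using that by auto
    show "?P (xs @ [x, w])" if "w \<in> D" for xs x w using that by auto
    show "ear U u0 ps0 v0" "set ps0 \<subseteq> K" "?P ps0" using ex .
    fix u ps v W
    assume *: "ear U u ps v" "set ps \<subseteq> K" "?P ps" "W \<subseteq> D - U - set ps"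
      "\<forall>w\<in>W. \<exists>x\<in>set ps. (x, w) \<in> E" "\<forall>w\<in>W. \<forall>z\<in>U. (w, z) \<notin> E"
      "length ps + 2 \<le> 3 * card (D \<inter> set ps) + card W +
         (if hd ps \<in> D then 0 else wt {} u) + (if last ps \<in> D then 0 else wt {} v)"
    show thesis by (rule that[OF *(1,2) card_D_pos[OF *(3)] *(4-7)])
  qed
qed

text \<open>
  All ears inside the component behind \<open>c\<close> are closed at \<open>c\<close>. If none of them meets \<open>D\<close>, every
  vertex of such an ear is a cut vertex with a dominator of its own behind it.
\<close>

lemma state_extend_at_hook:
  assumes st: "state U C T" and c: "c \<in> C"
  shows "\<exists>U' C' T'. state U' C' T' \<and> U \<subset> U'"
proof -
  have UV: "U \<subseteq> V" and CU: "C \<subseteq> U" and cD: "c \<in> U" "c \<notin> D" and TD: "T \<subseteq> D - U"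
    and Tu: "\<And>y. y \<in> T \<Longrightarrow> \<exists>u\<in>U - C. (u, y) \<in> E"
    using st c by (auto simp: state_def hook_def)
  obtain y where y: "y \<in> D - U" and only': "\<forall>z\<in>comp U y. \<forall>v\<in>U. (z, v) \<in> E \<longrightarrow> v = c"
    using st c unfolding state_def hook_def by blast
  note only = only'[rule_format]
  let ?K = "comp U y"
  have yV: "y \<in> V" "y \<notin> U" using y D_subset by auto
  have K: "\<And>x z. x \<in> ?K \<Longrightarrow> (x, z) \<in> E \<Longrightarrow> z \<notin> U \<Longrightarrow> z \<in> ?K" using comp_closed[OF yV(2)] .
  have K_U: "?K \<inter> U = {}" using comp_outside[OF yV(2)] by blast
  have ends: "u = c \<and> v = c" if e: "ear U u ps v" "set ps \<subseteq> ?K" for u ps v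
  proof -
    have ne: "ps \<noteq> []" and uv: "u \<in> U" "v \<in> U" "(hd ps, u) \<in> E" "(last ps, v) \<in> E"
      using e(1) E_sym by (simp_all add: ear_def)
    have "hd ps \<in> ?K" "last ps \<in> ?K" using e(2) ne by auto
    then show ?thesis using only uv by blast
  qed
  have fin: "finite C" "finite T" using state_finite[OF st] by auto
  have card_C: "card C = Suc (card (C - {c}))" using card.remove[OF fin(1) c] .
  have wc: "wt C c = 2" "wt {} c = 1" using c cD by (auto simp: wt_def)
  obtain w v where wv: "w \<in> ?K" "v \<in> U" "(w, v) \<in> E" by (rule comp_attached[OF yV UV]) (use cD(1) in auto)
  have cw: "(c, w) \<in> E" using E_sym[OF wv(3)] only[OF wv] by simp
  have wU: "w \<notin> U" using wv(1) K_U by blast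
  obtain ps0 v0 where ps0: "ear U c ps0 v0" "set ps0 \<subseteq> comp U w"
    by (rule ear_through_edge[OF cD(1) wU cw])
  then have ps0K: "set ps0 \<subseteq> ?K" using comp_eq[OF wv(1)] by simp
  have keep: "hook (U \<union> S) c'" if c': "c' \<in> C - {c}" "S \<subseteq> ?K" for c' S
  proof (rule hook_preserved[OF _ UV yV only c'(2)])
    show "hook U c'" using st c'(1) by (simp add: state_def)
  qed (use c'(1) in auto)
  show ?thesis
  proof (cases "\<exists>u ps v. ear U u ps v \<and> set ps \<subseteq> ?K \<and> set ps \<inter> D \<noteq> {}")
    case True
    then obtain u1 ps1 v1 where ex: "ear U u1 ps1 v1" "set ps1 \<subseteq> ?K" "set ps1 \<inter> D \<noteq> {}" by blast
    obtain u ps v W where e: "ear U u ps v" "set ps \<subseteq> ?K" and j: "1 \<le> card (D \<inter> set ps)"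
      and W: "W \<subseteq> D - U - set ps" "\<forall>w\<in>W. \<exists>x\<in>set ps. (x, w) \<in> E"
        "\<forall>w\<in>W. \<forall>z\<in>U. (w, z) \<notin> E"
      and m: "length ps + 2 \<le> 3 * card (D \<inter> set ps) + card W +
         (if hd ps \<in> D then 0 else wt {} u) + (if last ps \<in> D then 0 else wt {} v)"
      by (rule good_ear_with_D[OF K ex])
    have uv: "u = c" "v = c" using ends[OF e] by auto
    have psU: "set ps \<inter> U = {}" using e K_U by blast
    have "finite W" using W(1) D_subset finite_V by (meson Diff_subset finite_subset order_trans)
    moreover have "T \<inter> W = {}" using Tu W(3) E_sym by blast
    ultimately have card_T: "card (T \<union> W) = card T + card W" using fin by (intro card_Un_disjoint) auto
    \<comment> \<open>Here the clause \<open>u \<in> U - C\<close> of \<open>state\<close> pays off: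
      a vertex of \<open>T\<close> touches \<open>U\<close> outside the hooks, so it never lies
      behind \<open>c\<close>, and no credit of \<open>T\<close> is lost together with that of
      \<open>c\<close>.\<close>
    have T_ps: "T \<inter> set ps = {}"
    proof (rule ccontr)
      assume "T \<inter> set ps \<noteq> {}"
      then obtain x where x: "x \<in> T" "x \<in> ?K" using e(2) by blast
      then obtain u' where u': "u' \<in> U - C" "(u', x) \<in> E" using Tu by blast
      then have "u' = c" using only[OF x(2), of u'] E_sym by simp
      then show False using u'(1) c by simp
    qed
    have C_ps: "(C - {c}) \<inter> set ps = {}" using psU CU by blast
    have wt_ps: "wt (C - {c}) x = (if x \<in> D then 2 else 1)" if "x \<in> set ps" for x
      using that psU CU by (auto simp: wt_def)
    have hl: "hd ps \<in> set ps" "last ps \<in> set ps" using e by (auto simp: ear_def)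
    show ?thesis
    proof (rule state_extend[OF st e(1), of "C - {c}" "T \<union> W"])
      show "hook (U \<union> set ps) c'" if "c' \<in> C - {c}" for c' using keep[OF that e(2)] .
      show "T \<union> W \<subseteq> D - U - set ps" using TD W(1) T_ps by blast
      show "\<exists>x\<in>U \<union> set ps - (C - {c}). (x, y) \<in> E" if "y \<in> T \<union> W" for y
        using that Tu W(2) psU CU by blast
      \<comment> \<open>Removing \<open>c\<close> from the hooks costs two units. The estimate for
        the ear counts both ends with weight 1, whereas both equal \<open>c\<close> and weigh 2 in
        the old routing, which makes up for it.\<close>
      show "length ps + wt (C - {c}) x + wt (C - {c}) y + 2 * card C + card T
        \<le> 4 * card (D \<inter> set ps) + 2 * card (C - {c}) + card (T \<union> W) + wt C u + wt C v"
        if "x \<in> set ps" "y \<in> set ps" "x \<noteq> y" for x y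
        using wt_add_le[OF that C_ps] m j
        unfolding card_C card_T uv wc by (auto split: if_splits)
      show "2 * card C + card T \<le> 4 * card (D \<inter> set ps) + 2 * card (C - {c}) + card (T \<union> W)"
        using j by (simp add: card_C card_T)
      show "length ps + wt (C - {c}) (last ps) + 2 * card C + card T
        \<le> 4 * card (D \<inter> set ps) + 2 * card (C - {c}) + card (T \<union> W) + wt C u"
        using m j unfolding card_C card_T uv wc wt_ps[OF hl(2)]
        by (cases "hd ps \<in> D"; cases "last ps \<in> D") simp_all
      show "length ps + wt (C - {c}) (hd ps) + 2 * card C + card T
        \<le> 4 * card (D \<inter> set ps) + 2 * card (C - {c}) + card (T \<union> W) + wt C v"
        using m j unfolding card_C card_T uv wc wt_ps[OF hl(1)]
        by (cases "hd ps \<in> D"; cases "last ps \<in> D") simp_all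
    qed auto
  next
    case False
    let ?X = "set ps0"
    have e: "v0 = c" using ends[OF ps0(1) ps0K] by blast
    have noD: "?X \<inter> D = {}" using False ps0(1) ps0K by blast
    have psU: "?X \<inter> U = {}" "distinct ps0" "length ps0 \<noteq> 1" "ps0 \<noteq> []" using ps0(1) e by (auto simp: ear_def)
    have card_X: "card ?X = length ps0" "2 \<le> length ps0"
      using psU by (simp add: distinct_card, cases ps0) (auto simp: Suc_le_eq)
    have "card (C - {c} \<union> ?X) = card (C - {c}) + card ?X"
      using psU CU fin by (intro card_Un_disjoint) auto
    then have card_C': "card (C - {c} \<union> ?X) = card (C - {c}) + length ps0" using card_X by simp
    have wt_X: "wt (C - {c} \<union> ?X) x = 2" if "x \<in> ?X" for x using that by (simp add: wt_def)
    \<comment> \<open>A dominator of \<open>x\<close> in \<open>U\<close> could only be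
      \<open>c\<close>, which is not in \<open>D\<close>. So it lies outside \<open>U\<close>, and
      on no ear inside \<open>?K\<close> because these avoid \<open>D\<close>.\<close>
    have new: "hook (U \<union> ?X) x" if x: "x \<in> ?X" for x
    proof -
      have "x \<in> V - D" using x noD ear_V[OF ps0(1)] by blast
      then obtain p where p: "p \<in> D" "(x, p) \<in> E" using dominated by blast
      have "p \<notin> U" using only[of x p] p x ps0K cD by blast
      show ?thesis
      proof (rule hook_of_branch[OF ps0(1) ps0K K, where p = p and y = p])
        show "p \<notin> set qs" if "ear U u qs v" "set qs \<subseteq> ?K" for u qs v using False that p(1) by blast
      qed (use p \<open>p \<notin> U\<close> x noD comp_self in auto)
    qed
    show ?thesis
    proof (rule state_extend[OF st ps0(1), of "C - {c} \<union> ?X" T])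
      show "hook (U \<union> ?X) c'" if "c' \<in> C - {c} \<union> ?X" for c' using new keep[OF _ ps0K] that by blast
      show "\<exists>x\<in>U \<union> ?X - (C - {c} \<union> ?X). (x, y) \<in> E" if "y \<in> T" for y using Tu[OF that] psU by blast
      \<comment> \<open>All ear vertices become hooks of weight 2. The inequality amounts to
        \<open>length ps0 \<ge> 2\<close>, which holds because a closed ear has more than one inner
        vertex.\<close>
      show "length ps0 + wt (C - {c} \<union> ?X) x + wt (C - {c} \<union> ?X) y + 2 * card C + card T
        \<le> 4 * card (D \<inter> ?X) + 2 * card (C - {c} \<union> ?X) + card T + wt C c + wt C v0"
        if "x \<in> ?X" "y \<in> ?X" for x y
        using card_X(2) unfolding card_C card_C' e wc wt_X[OF that(1)] wt_X[OF that(2)] by simp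
      show "length ps0 + wt (C - {c} \<union> ?X) (last ps0) + 2 * card C + card T
        \<le> 4 * card (D \<inter> ?X) + 2 * card (C - {c} \<union> ?X) + card T + wt C c"
        using card_X(2) unfolding card_C card_C' wc wt_X[OF last_in_set[OF psU(4)]] by simp
      show "length ps0 + wt (C - {c} \<union> ?X) (hd ps0) + 2 * card C + card T
        \<le> 4 * card (D \<inter> ?X) + 2 * card (C - {c} \<union> ?X) + card T + wt C v0"
        using card_X(2) unfolding card_C card_C' e wc wt_X[OF hd_in_set[OF psU(4)]] by simp
      show "2 * card C + card T \<le> 4 * card (D \<inter> ?X) + 2 * card (C - {c} \<union> ?X) + card T"
        using card_X(2) unfolding card_C card_C' by simp
      show "T \<subseteq> D - U - ?X" using TD noD by blast
      show "(C - {c} \<union> ?X) \<inter> U \<subseteq> C" using psU(1) by blast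
    qed
  qed
qed

text \<open>
  Ears start at a vertex of \<open>T\<close>. An ear may absorb several vertices of \<open>T\<close> and lose their credit, but
  then minimality forces its last vertex into \<open>D\<close>, which saves as much.
\<close>

lemma state_extend_at_touched:
  assumes st: "state U {} T" and y: "y \<in> T"
  shows "\<exists>U' C' T'. state U' C' T' \<and> U \<subset> U'"
proof -
  have TD: "T \<subseteq> D - U" and Tu: "\<And>y. y \<in> T \<Longrightarrow> \<exists>u\<in>U. (u, y) \<in> E"
    using st by (auto simp: state_def)
  obtain u0 where u0: "u0 \<in> U" "(u0, y) \<in> E" using Tu y by blast
  obtain ps0 v0 where ps0: "ear U u0 ps0 v0" "hd ps0 = y" using ear_through_edge[of u0 U y] u0 y TD by blast
  \<comment> \<open>All surgeries needed for the minimality argument can keep the first vertex of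
    the ear, so this property survives them.\<close>
  let ?P = "\<lambda>ps. ps \<noteq> [] \<and> hd ps \<in> T"
  have "\<exists>u ps v W. ear U u ps v \<and> ?P ps \<and> W \<subseteq> D - U - set ps \<and>
    (\<forall>w\<in>W. \<exists>x\<in>set ps. (x, w) \<in> E) \<and> (\<forall>w\<in>W. \<forall>z\<in>U. (w, z) \<notin> E) \<and>
    length ps + 2 \<le> 3 * card (D \<inter> set ps) + card W +
       (if hd ps \<in> D then 0 else wt {} u) + (if last ps \<in> D then 0 else wt {} v) \<and>
    (\<forall>u' qs v'. ear U u' qs v' \<longrightarrow> ?P qs \<longrightarrow>
       length (filter (\<lambda>x. x \<notin> D) ps) \<le> length (filter (\<lambda>x. x \<notin> D) qs))"
  proof (rule good_ear[of "- U" U ?P u0 ps0 v0])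
    show "set ps \<inter> D \<noteq> {}" if "?P ps" for ps using that TD hd_in_set[of ps] by blast
    show "ear U u0 ps0 v0" "set ps0 \<subseteq> - U" "?P ps0" using ps0 y by (auto simp: ear_def)
    fix u ps v W
    assume *: "ear U u ps v" "?P ps" "W \<subseteq> D - U - set ps"
      "\<forall>w\<in>W. \<exists>x\<in>set ps. (x, w) \<in> E" "\<forall>w\<in>W. \<forall>z\<in>U. (w, z) \<notin> E"
      "length ps + 2 \<le> 3 * card (D \<inter> set ps) + card W +
         (if hd ps \<in> D then 0 else wt {} u) + (if last ps \<in> D then 0 else wt {} v)"
      "\<forall>u' qs v'. ear U u' qs v' \<longrightarrow> set qs \<subseteq> - U \<longrightarrow> ?P qs \<longrightarrow>
         length (filter (\<lambda>x. x \<notin> D) ps) \<le> length (filter (\<lambda>x. x \<notin> D) qs)"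
    have "\<forall>u' qs v'. ear U u' qs v' \<longrightarrow> ?P qs \<longrightarrow>
         length (filter (\<lambda>x. x \<notin> D) ps) \<le> length (filter (\<lambda>x. x \<notin> D) qs)"
    proof (intro allI impI)
      fix u' qs v' assume q: "ear U u' qs v'" "?P qs"
      then have "set qs \<subseteq> - U" by (auto simp: ear_def)
      then show "length (filter (\<lambda>x. x \<notin> D) ps) \<le> length (filter (\<lambda>x. x \<notin> D) qs)" using *(7) q by blast
    qed
    with *(1-6) show ?thesis by (intro exI[of _ u] exI[of _ ps] exI[of _ v] exI[of _ W]) simp
  qed (auto simp: hd_append_Cons split: if_splits)
  then obtain u ps v W where e: "ear U u ps v" and P: "ps \<noteq> []" "hd ps \<in> T" and W: "W \<subseteq> D - U - set ps"
    and Wx: "\<forall>w\<in>W. \<exists>x\<in>set ps. (x, w) \<in> E" and Wz: "\<forall>w\<in>W. \<forall>z\<in>U. (w, z) \<notin> E"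
    and m: "length ps + 2 \<le> 3 * card (D \<inter> set ps) + card W +
       (if hd ps \<in> D then 0 else wt {} u) + (if last ps \<in> D then 0 else wt {} v)"
    and min: "\<forall>u' qs v'. ear U u' qs v' \<longrightarrow> ?P qs \<longrightarrow>
       length (filter (\<lambda>x. x \<notin> D) ps) \<le> length (filter (\<lambda>x. x \<notin> D) qs)" by (elim exE conjE) rule
  have psU: "set ps \<inter> U = {}" "distinct ps" using e by (auto simp: ear_def)
  have hdD: "hd ps \<in> D" using P TD by blast
  have hl: "hd ps \<in> set ps" "last ps \<in> set ps" using P by auto
  have j: "1 \<le> card (D \<inter> set ps)" using card_D_pos hl hdD by blast
  \<comment> \<open>At a second vertex of \<open>T\<close> the ear can be cut towards
    \<open>U\<close>. Minimality then allows only vertices of \<open>D\<close> in the part cut off,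
    including the last one.\<close>
  have only_hd: "T \<inter> set ps = {hd ps}" if lastD: "last ps \<notin> D"
  proof (rule ccontr)
    assume "T \<inter> set ps \<noteq> {hd ps}"
    then obtain x where x: "x \<in> T" "x \<in> set ps" "x \<noteq> hd ps" using P hl by blast
    then obtain xs ys where s: "ps = xs @ x # ys" by (meson split_list)
    have xs: "xs \<noteq> []" using s x by auto
    have ys: "ys \<noteq> []" using s lastD x TD by auto
    obtain z where "z \<in> U" "(x, z) \<in> E" using Tu[OF x(1)] E_sym by blast
    then have "ear U u (xs @ [x]) z" using ear_cut_right e s xs by blast
    moreover have "?P (xs @ [x])" using P s xs by simp
    ultimately have "length (filter (\<lambda>x. x \<notin> D) ps) \<le> length (filter (\<lambda>x. x \<notin> D) (xs @ [x]))" using min by blast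
    then have "filter (\<lambda>x. x \<notin> D) ys = []" unfolding s by (cases "x \<in> D") simp_all
    then have "last ys \<in> D" using ys by (simp add: filter_empty_conv)
    then show False using lastD s ys by simp
  qed
  have fin: "finite T" "finite W" using state_finite[OF st] W D_subset finite_V
    by (blast, meson Diff_subset finite_subset order_trans)
  have "(T - set ps) \<inter> W = {}" using Tu Wz E_sym by blast
  then have "card ((T - set ps) \<union> W) = card (T - set ps) + card W" using fin by (intro card_Un_disjoint) auto
  moreover have "card T = card (T \<inter> set ps) + card (T - set ps)"
    using card_Int_Diff[OF fin(1)] .
  ultimately have card_T: "card T + card W = card (T \<inter> set ps) + card ((T - set ps) \<union> W)" by simp
  have jT: "card (T \<inter> set ps) \<le> card (D \<inter> set ps)" using TD by (intro card_mono) auto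
  have jT1: "last ps \<notin> D \<Longrightarrow> card (T \<inter> set ps) = 1" using only_hd by simp
  have wt: "1 \<le> wt {} u" "1 \<le> wt {} v" "wt {} u \<le> 2" "wt {} v \<le> 2" by (auto simp: wt_def)
  have wt_D: "wt {} x = (if x \<in> D then 2 else 1)" for x by (simp add: wt_def)
  show ?thesis
  proof (rule state_extend[OF st e, of "{}" "(T - set ps) \<union> W"])
    show "T - set ps \<union> W \<subseteq> D - U - set ps" using TD W by blast
    show "\<exists>x\<in>U \<union> set ps - {}. (x, y) \<in> E" if "y \<in> T - set ps \<union> W" for y using that Tu Wx by blast
    \<comment> \<open>If \<open>last ps\<close> is outside \<open>D\<close>, one credit is lost, and
      the end \<open>u\<close>, which the estimate counts as 0, returns it. Otherwise up to
      \<open>card (D \<inter> set ps)\<close> credits are lost; then both ends count as 0 in the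
      estimate, and the weights of \<open>x\<close> and \<open>y\<close> are bounded by 4
      instead.\<close>
    show "length ps + wt {} x + wt {} y + 2 * card {} + card T
        \<le> 4 * card (D \<inter> set ps) + 2 * card {} + card (T - set ps \<union> W) + wt {} u + wt {} v"
      if "x \<in> set ps" "y \<in> set ps" "x \<noteq> y" for x y
      using wt_add_le[OF that, of "{}"] m j jT jT1 wt card_T hdD
      by (cases "last ps \<in> D") simp_all
    show "length ps + wt {} (last ps) + 2 * card {} + card T
        \<le> 4 * card (D \<inter> set ps) + 2 * card {} + card (T - set ps \<union> W) + wt {} u"
      using m j jT jT1 wt card_T hdD by (cases "last ps \<in> D") (simp_all add: wt_D[of "last ps"])
    show "length ps + wt {} (hd ps) + 2 * card {} + card T
        \<le> 4 * card (D \<inter> set ps) + 2 * card {} + card (T - set ps \<union> W) + wt {} v"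
      using m j jT jT1 wt card_T hdD by (cases "last ps \<in> D") (simp_all add: wt_D[of "hd ps"])
  qed (use j jT card_T in auto)
qed

text \<open>With no debts left, the estimate for a minimal ear is just what the extension needs, and
  its dominators off the ear become the new \<open>T\<close>.\<close>

lemma state_extend_if_ear_meets_D:
  assumes st: "state U {} {}" and ex: "ear U u0 ps0 v0" "set ps0 \<inter> D \<noteq> {}"
  shows "\<exists>U' C' T'. state U' C' T' \<and> U \<subset> U'"
proof -
  have "set ps0 \<subseteq> - U" using ex by (auto simp: ear_def)
  then have ex': "set ps0 \<subseteq> - U" by simp
  have K: "\<And>x y. x \<in> - U \<Longrightarrow> (x, y) \<in> E \<Longrightarrow> y \<notin> U \<Longrightarrow> y \<in> - U" by simp
  obtain u ps v W where e: "ear U u ps v" and j: "1 \<le> card (D \<inter> set ps)" and W: "W \<subseteq> D - U - set ps"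
    and Wx: "\<forall>w\<in>W. \<exists>x\<in>set ps. (x, w) \<in> E"
    and m: "length ps + 2 \<le> 3 * card (D \<inter> set ps) + card W +
       (if hd ps \<in> D then 0 else wt {} u) + (if last ps \<in> D then 0 else wt {} v)"
    by (rule good_ear_with_D[OF K ex(1) ex' ex(2)])
  have wt: "1 \<le> wt {} u" "1 \<le> wt {} v" "wt {} u \<le> 2" "wt {} v \<le> 2" by (auto simp: wt_def)
  have wt_D: "wt {} x = (if x \<in> D then 2 else 1)" for x by (simp add: wt_def)
  show ?thesis
  proof (rule state_extend[OF st e, of "{}" W])
    show "\<exists>x\<in>U \<union> set ps - {}. (x, y) \<in> E" if "y \<in> W" for y using that Wx by blast
    show "length ps + wt {} x + wt {} y + 2 * card {} + card {}
        \<le> 4 * card (D \<inter> set ps) + 2 * card {} + card W + wt {} u + wt {} v"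
      if "x \<in> set ps" "y \<in> set ps" "x \<noteq> y" for x y
      using wt_add_le[OF that, of "{}"] m j by (auto split: if_splits)
    show "length ps + wt {} (last ps) + 2 * card {} + card {}
        \<le> 4 * card (D \<inter> set ps) + 2 * card {} + card W + wt {} u"
      using m j wt by (auto simp add: wt_D[of "last ps"] split: if_splits)
    show "length ps + wt {} (hd ps) + 2 * card {} + card {}
        \<le> 4 * card (D \<inter> set ps) + 2 * card {} + card W + wt {} v"
      using m j wt by (auto simp add: wt_D[of "hd ps"] split: if_splits)
  qed (use W in auto)
qed

text \<open>When no ear meets \<open>D\<close>, a dominator outside \<open>U\<close> lies on no ear.
  An ear vertex without a dominator in \<open>U\<close> thus becomes a hook as soon as the ear is
  added, and its two units pay for its place and its weight.\<close>

lemma state_extend_if_far_ear_vertex: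
  assumes st: "state U {} {}" and noD: "\<And>u ps v. ear U u ps v \<Longrightarrow> set ps \<inter> D = {}"
    and ex: "ear U u0 ps0 v0" "x0 \<in> set ps0" "\<forall>z\<in>D \<inter> U. (x0, z) \<notin> E"
  shows "\<exists>U' C' T'. state U' C' T' \<and> U \<subset> U'"
proof -
  let ?far = "\<lambda>x. \<forall>z\<in>D \<inter> U. (x, z) \<notin> E"
  let ?cand = "\<lambda>ps. (\<exists>u v. ear U u ps v) \<and> (\<exists>x\<in>set ps. ?far x)"
  have "?cand ps0" using ex by blast
  then obtain ps where ps: "?cand ps" "\<forall>qs. ?cand qs \<longrightarrow> length ps \<le> length qs"
    using ex_has_least_nat[of ?cand ps0 length] by blast
  obtain u v where ear: "ear U u ps v" using ps(1) by blast
  let ?m = "length ps"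
  define X where "X = {x \<in> set ps. ?far x}"
  have X: "X \<subseteq> set ps" "X \<noteq> {}" "finite X" using ps(1) by (auto simp: X_def)
  have e: "ps \<noteq> []" "distinct ps" "set ps \<inter> U = {}" using ear by (auto simp: ear_def)
  \<comment> \<open>A shortest ear with such a vertex cannot be cut: at an inner vertex dominated
    from \<open>U\<close> it would split into two shorter ears, one of them still containing a
    vertex of \<open>X\<close>.\<close>
  have ends: "x = hd ps \<or> x = last ps" if x: "x \<in> set ps - X" for x
  proof (rule ccontr)
    assume ne: "\<not> ?thesis"
    obtain xs ys where s: "ps = xs @ x # ys" using x by (meson DiffD1 split_list)
    have "xs \<noteq> []" "ys \<noteq> []" using ne s by auto
    obtain z where z: "z \<in> D \<inter> U" "(x, z) \<in> E" using x by (auto simp: X_def)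
    have "ear U u (xs @ [x]) z" "ear U z (x # ys) v"
      using ear_cut_right[of U u xs x ys v z] ear_cut_left[of U u xs x ys v z] ear z s \<open>xs \<noteq> []\<close> \<open>ys \<noteq> []\<close> by auto
    moreover obtain x' where x': "x' \<in> set ps" "?far x'" using ps(1) by blast
    moreover have "x' \<in> set (xs @ [x]) \<or> x' \<in> set (x # ys)" using x' s by auto
    ultimately have "?cand (xs @ [x]) \<or> ?cand (x # ys)" by blast
    then have "length ps \<le> length (xs @ [x]) \<or> length ps \<le> length (x # ys)" using ps(2) by blast
    then show False using s \<open>xs \<noteq> []\<close> \<open>ys \<noteq> []\<close> by simp
  qed
  have m: "?m \<le> card X + (if hd ps \<in> X then 0 else 1) + (if last ps \<in> X then 0 else 1)"
  proof -
    have "set ps \<subseteq> X \<union> ({hd ps} - X) \<union> ({last ps} - X)" using ends by blast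
    then have "card (set ps) \<le> card (X \<union> ({hd ps} - X) \<union> ({last ps} - X))" using X(3) by (intro card_mono) auto
    also have "\<dots> \<le> card X + card ({hd ps} - X) + card ({last ps} - X)"
      by (intro order_trans[OF card_Un_le] add_right_mono card_Un_le)
    finally show ?thesis using e(2)
      by (cases "hd ps \<in> X"; cases "last ps \<in> X") (simp_all add: distinct_card insert_Diff_if)
  qed
  have near: "\<exists>z. z \<in> D \<and> z \<in> U \<and> (x, z) \<in> E" if "x \<in> set ps - X" for x using that by (auto simp: X_def)
  define u' where "u' = (if hd ps \<in> X then u else SOME z. z \<in> D \<and> z \<in> U \<and> (hd ps, z) \<in> E)"
  define v' where "v' = (if last ps \<in> X then v else SOME z. z \<in> D \<and> z \<in> U \<and> (last ps, z) \<in> E)"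
  have u'X: "u' \<in> D \<and> u' \<in> U \<and> (hd ps, u') \<in> E" if "hd ps \<notin> X"
    using someI_ex[OF near, of "hd ps"] that e(1) by (simp add: u'_def)
  have v'X: "v' \<in> D \<and> v' \<in> U \<and> (last ps, v') \<in> E" if "last ps \<notin> X"
    using someI_ex[OF near, of "last ps"] that e(1) by (simp add: v'_def)
  have ear': "ear U u' ps v'"
  proof (cases "?m = 1")
    case True
    then obtain a where "ps = [a]" by (auto simp: length_Suc_conv)
    then have "hd ps \<in> X" "last ps \<in> X" using X by auto
    then show ?thesis using ear by (simp add: u'_def v'_def)
  next
    case False
    have "(u', hd ps) \<in> E \<and> u' \<in> U"
      using u'X ear E_sym by (cases "hd ps \<in> X") (auto simp: u'_def ear_def)
    moreover have "(last ps, v') \<in> E \<and> v' \<in> U"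
      using v'X ear by (cases "last ps \<in> X") (auto simp: v'_def ear_def)
    ultimately show ?thesis using ear_change_ends[OF ear False] by blast
  qed
  have wt_ends: "(if hd ps \<in> X then 1 else 2) \<le> wt {} u'" "(if last ps \<in> X then 1 else 2) \<le> wt {} v'"
    using u'X v'X by (auto simp: wt_def)
  have wt_X: "wt X x = (if x \<in> X then 2 else 1)" if "x \<in> set ps" for x
    using that noD[OF ear] by (auto simp: wt_def)
  have X_pos: "1 \<le> card X" using X by (simp add: Suc_le_eq card_gt_0_iff)
  have X_two: "2 \<le> card X" if "x \<in> X" "y \<in> X" "x \<noteq> y" for x y
    using card_mono[OF X(3), of "{x, y}"] that by simp
  have hooks: "hook (U \<union> set ps) x" if x: "x \<in> X" for x
  proof -
    have xps: "x \<in> set ps" using x X by blast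
    then have "x \<in> V - D" using noD[OF ear] ear_V[OF ear] by blast
    then obtain p where p: "p \<in> D" "(x, p) \<in> E" using dominated by blast
    have "p \<notin> U" using x p by (auto simp: X_def)
    show ?thesis
    proof (rule hook_of_branch[OF ear', where K = "- U" and p = p and y = p])
      show "p \<notin> set qs" if "ear U u qs v" for u qs v using noD[OF that] p(1) by blast
    qed (use e xps p \<open>p \<notin> U\<close> \<open>x \<in> V - D\<close> comp_self in auto)
  qed
  show ?thesis
  proof (rule state_extend[OF st ear', of X "{}"])
    show "length ps + wt X (last ps) + 2 * card {} + card {}
      \<le> 4 * card (D \<inter> set ps) + 2 * card X + card {} + wt {} u'"
      using m wt_ends X_pos unfolding wt_X[OF last_in_set[OF e(1)]]
      by (cases "hd ps \<in> X"; cases "last ps \<in> X") simp_all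
    show "length ps + wt X (hd ps) + 2 * card {} + card {}
      \<le> 4 * card (D \<inter> set ps) + 2 * card X + card {} + wt {} v'"
      using m wt_ends X_pos unfolding wt_X[OF hd_in_set[OF e(1)]]
      by (cases "hd ps \<in> X"; cases "last ps \<in> X") simp_all
    show "length ps + wt X x + wt X y + 2 * card {} + card {}
      \<le> 4 * card (D \<inter> set ps) + 2 * card X + card {} + wt {} u' + wt {} v'"
      if xy: "x \<in> set ps" "y \<in> set ps" "x \<noteq> y" for x y
    proof -
      \<comment> \<open>One unit per hook covers the weights and the other covers the length in
        \<open>m\<close>; ear vertices outside \<open>X\<close> are ends and are paid by the weight
        2 of \<open>u'\<close> or \<open>v'\<close>.\<close>
      have "wt X x + wt X y \<le> 2 + card X"
        using X_two[OF _ _ xy(3)] X_pos unfolding wt_X[OF xy(1)] wt_X[OF xy(2)]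
        by (cases "x \<in> X"; cases "y \<in> X") simp_all
      then show ?thesis using m wt_ends by (cases "hd ps \<in> X"; cases "last ps \<in> X") simp_all
    qed
  qed (use hooks X e in auto)
qed

text \<open>Here the hook comes from the connection of \<open>y\<close> to \<open>U\<close>. On a
  walk from \<open>y\<close>, the last vertex \<open>p\<close> before \<open>U\<close> or an ear is
  met lies on no ear, so the vertex \<open>c\<close> met next separates \<open>y\<close> from the
  rest once an ear through \<open>c\<close> is added.\<close>

lemma state_extend_if_ears_near_D:
  assumes st: "state U {} {}" and noD: "\<And>u ps v. ear U u ps v \<Longrightarrow> set ps \<inter> D = {}"
    and near: "\<And>u ps v x. ear U u ps v \<Longrightarrow> x \<in> set ps \<Longrightarrow> \<exists>z\<in>D \<inter> U. (x, z) \<in> E"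
    and y: "y \<in> D - U"
  shows "\<exists>U' C' T'. state U' C' T' \<and> U \<subset> U'"
proof -
  have UV: "U \<subseteq> V" "D \<inter> U \<noteq> {}" using st by (auto simp: state_def)
  define Q where "Q = {x. \<exists>u ps v. ear U u ps v \<and> x \<in> set ps}"
  have yQ: "y \<notin> U \<union> Q" using y noD by (auto simp: Q_def)
  obtain u0 where u0: "u0 \<in> U" using UV by blast
  have "(y, u0) \<in> E\<^sup>*" using connected y u0 UV D_subset by blast
  then obtain p c where p: "(y, p) \<in> (E \<inter> (- (U \<union> Q)) \<times> (- (U \<union> Q)))\<^sup>*" "p \<notin> U \<union> Q"
    "(p, c) \<in> E" "c \<in> U \<union> Q" by (rule rtrancl_first_hit[OF _ yQ]) (use u0 in blast)
  \<comment> \<open>An edge from \<open>p\<close> into \<open>U\<close> would start an ear through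
    \<open>p\<close>.\<close>
  have cQ: "c \<in> Q"
  proof (rule ccontr)
    assume "c \<notin> Q"
    then have "c \<in> U" "p \<notin> U" using p by auto
    then obtain ps v where ps: "ear U c ps v" "hd ps = p" by (rule ear_through_edge[OF _ _ E_sym[OF p(3)]])
    then have "p \<in> set ps" by (auto simp: ear_def)
    then have "p \<in> Q" using ps(1) by (auto simp: Q_def)
    then show False using p(2) by blast
  qed
  let ?cand = "\<lambda>ps. (\<exists>u v. ear U u ps v) \<and> c \<in> set ps"
  obtain ps0 where "?cand ps0" using cQ by (auto simp: Q_def)
  then obtain ps where ps: "?cand ps" "\<forall>qs. ?cand qs \<longrightarrow> length ps \<le> length qs"
    using ex_has_least_nat[of ?cand ps0 length] by blast
  obtain u v where ear: "ear U u ps v" using ps(1) by blast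
  have c: "c \<in> set ps" using ps(1) by blast
  \<comment> \<open>Every ear vertex has a neighbour in \<open>U\<close>, so a shortest ear through
    \<open>c\<close> with three or more vertices could be cut at its second vertex.\<close>
  have short: "length ps = 1 \<or> (\<exists>a b. ps = [a, b])"
  proof (rule ccontr)
    assume ne: "\<not> ?thesis"
    obtain a b d rest where s: "ps = a # b # d # rest"
      using ne ear by (cases ps rule: remdups_adj.cases) (auto simp: ear_def neq_Nil_conv)
    obtain z where z: "z \<in> U" "(b, z) \<in> E" using near[OF ear, of b] s by auto
    have "ear U u [a, b] z" "ear U z (b # d # rest) v"
      using ear_cut_right[of U u "[a]" b "d # rest" v z] ear_cut_left[of U u "[a]" b "d # rest" v z] ear z s by auto
    moreover have "c \<in> set [a, b] \<or> c \<in> set (b # d # rest)" using c s by auto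
    ultimately have "?cand [a, b] \<or> ?cand (b # d # rest)" by blast
    then have "length ps \<le> length [a, b] \<or> length ps \<le> length (b # d # rest)" using ps(2) by blast
    then show False using s by simp
  qed
  have "\<exists>u' v'. ear U u' ps v' \<and> (length ps = 1 \<or> length ps = 2 \<and> u' \<in> D \<and> v' \<in> D)"
  proof (cases "length ps = 1")
    case True
    then show ?thesis using ear by blast
  next
    case False
    then obtain a b where s: "ps = [a, b]" using short by blast
    obtain z1 z2 where "z1 \<in> D \<inter> U" "(a, z1) \<in> E" "z2 \<in> D \<inter> U" "(b, z2) \<in> E"
      using near[OF ear, of a] near[OF ear, of b] s by auto
    then have "ear U z1 ps z2" using ear_change_ends[OF ear False, of z1 z2] s E_sym by auto
    then show ?thesis using \<open>z1 \<in> D \<inter> U\<close> \<open>z2 \<in> D \<inter> U\<close> s by auto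
  qed
  then obtain u' v' where ear': "ear U u' ps v'" and m: "length ps = 1 \<or> length ps = 2 \<and> u' \<in> D \<and> v' \<in> D" by blast
  have e: "ps \<noteq> []" "set ps \<inter> U = {}" using ear by (auto simp: ear_def)
  have cD: "c \<notin> D" using noD[OF ear] c by blast
  have psQ: "set ps \<subseteq> Q" using ear by (auto simp: Q_def)
  have hook: "hook (U \<union> set ps) c"
  proof (rule hook_of_branch[OF ear', where K = "- U" and p = p and y = y])
    show "p \<notin> set qs" if "ear U u qs v" for u qs v using p(2) that by (auto simp: Q_def)
    have "p \<in> comp (U \<union> Q) y" using p(1) by (simp add: comp_def outside_def)
    then have "y \<in> comp (U \<union> Q) p" using comp_eq comp_self by blast
    then show "y \<in> comp (U \<union> set ps) p" using comp_mono[of "U \<union> set ps" "U \<union> Q"] psQ by blast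
  qed (use c cD p y e E_sym in auto)
  have wt: "1 \<le> wt {} x" "wt {} x \<le> 2" "x \<in> D \<Longrightarrow> wt {} x = 2" for x by (auto simp: wt_def)
  have wt_c: "wt {c} x \<le> 2" "1 \<le> wt {c} x" for x by (auto simp: wt_def)
  have wt_ps: "x \<in> set ps \<Longrightarrow> wt {c} x = (if x = c then 2 else 1)" for x using noD[OF ear] by (auto simp: wt_def)
  show ?thesis
  proof (rule state_extend[OF st ear', of "{c}" "{}"])
    show "length ps + wt {c} (last ps) + 2 * card {} + card {}
      \<le> 4 * card (D \<inter> set ps) + 2 * card {c} + card {} + wt {} u'"
      using m wt(1)[of u'] wt(3)[of u'] wt_c(1)[of "last ps"] by auto
    show "length ps + wt {c} (hd ps) + 2 * card {} + card {}
      \<le> 4 * card (D \<inter> set ps) + 2 * card {c} + card {} + wt {} v'"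
      using m wt(1)[of v'] wt(3)[of v'] wt_c(1)[of "hd ps"] by auto
    show "length ps + wt {c} x + wt {c} y + 2 * card {} + card {}
      \<le> 4 * card (D \<inter> set ps) + 2 * card {c} + card {} + wt {} u' + wt {} v'"
      if xy: "x \<in> set ps" "y \<in> set ps" "x \<noteq> y" for x y
    proof -
      have "length ps \<noteq> 1" using xy by (auto simp: length_Suc_conv)
      then show ?thesis using m wt(3)[of u'] wt(3)[of v'] wt_c(1)[of x] wt_c(1)[of y] by auto
    qed
  qed (use hook c e in auto)
qed

section \<open>A routed set containing \<open>D\<close>\<close>

lemma exists_routed_core:
  obtains U where "D \<subseteq> U" "U \<subseteq> V" "routed U (wt {}) (4 * card D)"
proof -
  obtain x where x: "x \<in> D" using V_nonempty dominated by blast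
  \<comment> \<open>The only pair has distance 0 and weight 2 + 2, so the bound 4 for one vertex of
    \<open>D\<close> is attained.\<close>
  have "routed {x} (wt {}) 4"
    unfolding routed_def by (intro exI[of _ "{}"]) (auto simp: wt_def intro!: exI[of _ 0])
  then have "state {x} {} {}" using x D_subset by (auto simp: state_def)
  have "\<exists>U. (\<exists>C T. state U C T) \<and> (\<forall>U'. (\<exists>C T. state U' C T) \<longrightarrow> card U' \<le> card U)"
  proof -
    have "card U \<le> card V" if "\<exists>C T. state U C T" for U
      using that card_mono[OF finite_V] by (auto simp: state_def)
    then have b: "\<forall>U. (\<exists>C T. state U C T) \<longrightarrow> card U < Suc (card V)"
      by (simp add: less_Suc_eq_le)
    have "\<exists>C T. state {x} C T" using \<open>state {x} {} {}\<close> by blast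
    from ex_has_greatest_nat[of "\<lambda>U. \<exists>C T. state U C T", OF this b] show ?thesis .
  qed
  then obtain U C T where st: "state U C T" and max: "\<forall>U'. (\<exists>C T. state U' C T) \<longrightarrow> card U' \<le> card U" by blast
  have stuck: False if grow: "\<exists>U' C' T'. state U' C' T' \<and> U \<subset> U'"
  proof -
    obtain U' C' T' where s': "state U' C' T'" "U \<subset> U'" using grow by blast
    have "card U < card U'" using psubset_card_mono[OF state_finite(1)[OF s'(1)] s'(2)] .
    moreover have "card U' \<le> card U" using max s'(1) by blast
    ultimately show False by simp
  qed
  \<comment> \<open>The order matters: each growth lemma presupposes that the earlier ones no longer
    apply, so debts to hooks go first, then those to \<open>T\<close>, and the ears without vertices
    of \<open>D\<close> come last.\<close>
  have C: "C = {}" using stuck state_extend_at_hook[OF st] by blast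
  have T: "T = {}" using stuck state_extend_at_touched st unfolding C by blast
  have st0: "state U {} {}" using st unfolding C T .
  have noD: "set ps \<inter> D = {}" if e: "ear U u ps v" for u ps v
    using stuck[OF state_extend_if_ear_meets_D[OF st0 e]] by (rule ccontr)
  have near: "\<exists>z\<in>D \<inter> U. (x, z) \<in> E" if x: "ear U u ps v" "x \<in> set ps" for u ps v x
  proof (rule ccontr)
    assume "\<not> ?thesis"
    then have "\<forall>z\<in>D \<inter> U. (x, z) \<notin> E" by blast
    from state_extend_if_far_ear_vertex[OF st0 noD x this] show False by (rule stuck)
  qed
  have DU: "D \<subseteq> U"
  proof (rule subsetI, rule ccontr)
    fix y assume "y \<in> D" "y \<notin> U"
    then have "y \<in> D - U" by simp
    from state_extend_if_ears_near_D[OF st0 noD near this] show False by (rule stuck)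
  qed
  then have "D \<inter> U = D" by blast
  then show thesis using that[OF DU] st0 by (auto simp: state_def)
qed

subsection \<open>Orienting the remaining edges\<close>

lemma extend_to_orientation:
  assumes "B \<subseteq> E" and asym: "\<And>x y. (x, y) \<in> B \<Longrightarrow> (y, x) \<notin> B"
  obtains H where "B \<subseteq> H" "H \<subseteq> E" "\<forall>(x, y)\<in>E. (x, y) \<in> H \<longleftrightarrow> (y, x) \<notin> H"
proof -
  obtain f :: "'a \<Rightarrow> nat" where f: "inj_on f V" using finite_imp_inj_to_nat_seg[OF finite_V] by blast
  let ?H = "B \<union> {(x, y) \<in> E. (x, y) \<notin> B \<and> (y, x) \<notin> B \<and> f x < f y}"
  have "(x, y) \<in> ?H \<longleftrightarrow> (y, x) \<notin> ?H" if e: "(x, y) \<in> E" for x y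
  proof -
    have "x \<in> V" "y \<in> V" "x \<noteq> y" using e E_subset E_irrefl by auto
    then have "f x < f y \<or> f y < f x" using f by (metis inj_onD nat_neq_iff)
    then show ?thesis using e E_sym[OF e] asym[of x y] asym[of y x] by auto
  qed
  moreover have "?H \<subseteq> E" using assms(1) by auto
  ultimately show thesis using that[of ?H] by blast
qed

text \<open>Detours outside \<open>U\<close> may have length 2 at vertices of \<open>D\<close> and 1
  elsewhere, which is the slack kept by the weights. A maximal independent set \<open>I\<close>
  organises them: by maximality every other vertex outside \<open>U\<close> follows some vertex of
  \<open>I\<close>, so it is two steps from \<open>D\<close>; by independence an edge leaving
  \<open>I\<close> ends in \<open>U\<close> or at a vertex whose next step is its dominator.\<close>

theorem exists_short_orientation:
  obtains H where "H \<subseteq> E" "\<forall>(x, y)\<in>E. (x, y) \<in> H \<longleftrightarrow> (y, x) \<notin> H"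
    "\<forall>x\<in>V. \<forall>y\<in>V. \<exists>k. (x, y) \<in> H ^^ k \<and> k \<le> 4 * card D"
proof -
  obtain U where U: "D \<subseteq> U" "U \<subseteq> V" and r: "routed U (wt {}) (4 * card D)"
    by (rule exists_routed_core)
  obtain A where A: "A \<subseteq> E \<inter> U \<times> U" "\<forall>x y. (x, y) \<in> A \<longrightarrow> (y, x) \<notin> A"
    "\<forall>x\<in>U. \<forall>y\<in>U. \<exists>k. (x, y) \<in> A ^^ k \<and> k + wt {} x + wt {} y \<le> 4 * card D"
    using r unfolding routed_def by (elim exE conjE)
  let ?indep = "{I. I \<subseteq> V - U \<and> (\<forall>x\<in>I. \<forall>y\<in>I. (x, y) \<notin> E)}"
  have "?indep \<subseteq> Pow V" by blast
  then have fin: "finite ?indep" using finite_V by (simp add: finite_subset)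
  have "{} \<in> ?indep" by simp
  then have ne: "?indep \<noteq> {}" by (metis empty_iff)
  obtain I where I: "I \<in> ?indep" "\<forall>J\<in>?indep. I \<subseteq> J \<longrightarrow> I = J"
    using finite_has_maximal[OF fin ne] by (elim bexE) rule
  have IV: "I \<subseteq> V - U" and indep: "\<And>x y. x \<in> I \<Longrightarrow> y \<in> I \<Longrightarrow> (x, y) \<notin> E" using I(1) by simp_all
  have nbr: "\<exists>a\<in>I. (a, x) \<in> E" if x: "x \<in> V - U - I" for x
  proof (rule ccontr)
    assume ne: "\<not> ?thesis"
    then have a: "(y, x) \<notin> E" if "y \<in> I" for y using that by simp
    have b: "(x, y) \<notin> E" if y: "y \<in> I" for y
    proof
      assume "(x, y) \<in> E"
      then have "(y, x) \<in> E" by (rule E_sym)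
      then show False using a[OF y] by simp
    qed
    have "insert x I \<in> ?indep"
      using x IV a b indep E_irrefl by (simp add: ball_simps)
    then have "I = insert x I" using I(2) by (meson subset_insertI)
    then show False using x by blast
  qed
  have "\<forall>x\<in>V - U. \<exists>d. d \<in> D \<and> (x, d) \<in> E"
  proof
    fix x assume "x \<in> V - U"
    then have "x \<in> V - D" using U(1) by blast
    then show "\<exists>d. d \<in> D \<and> (x, d) \<in> E" using dominated[of x] by blast
  qed
  from bchoice[OF this] obtain d where d': "\<forall>x\<in>V - U. d x \<in> D \<and> (x, d x) \<in> E" by (elim exE)
  then have d: "\<And>x. x \<in> V - U \<Longrightarrow> d x \<in> D" "\<And>x. x \<in> V - U \<Longrightarrow> (x, d x) \<in> E" by simp_all
  have dU: "\<And>x. x \<in> V - U \<Longrightarrow> d x \<in> U" using d(1) U(1) by (rule subsetD[rotated])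
  \<comment> \<open>Enter \<open>I\<close> from the dominators, leave \<open>I\<close> along all other edges, and return to the dominators.\<close>
  define B where "B = A \<union> {(d x, x) | x. x \<in> I} \<union> {(x, w) | x w. x \<in> I \<and> (x, w) \<in> E \<and> w \<noteq> d x} \<union>
    {(b, d b) | b. b \<in> V - U - I}"
  have "B \<subseteq> E" using A(1) d E_sym IV by (auto simp: B_def)
  moreover have "(y, x) \<notin> B" if xy: "(x, y) \<in> B" for x y
  proof -
    consider "(x, y) \<in> A" | "y \<in> I" "x = d y" | "x \<in> I" "(x, y) \<in> E" "y \<noteq> d x" | "x \<in> V - U - I" "y = d x"
      using xy by (auto simp: B_def)
    then show ?thesis
    proof cases
      case 1
      then have "x \<in> U" "y \<in> U" using A(1) by auto
      then show ?thesis using 1 A(2) IV by (auto simp: B_def)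
    next
      case 2
      then show ?thesis using dU[of y] A(1) IV by (auto simp: B_def)
    next
      case 3
      then have "y \<notin> I" "x \<notin> U" "\<And>b. b \<in> V - U \<Longrightarrow> x \<noteq> d b" using indep IV dU by blast+
      then show ?thesis using 3 A(1) by (auto simp: B_def)
    next
      case 4
      then show ?thesis using dU[of x] A(1) IV by (auto simp: B_def)
    qed
  qed
  ultimately obtain H where H: "B \<subseteq> H" "H \<subseteq> E" "\<forall>(x, y)\<in>E. (x, y) \<in> H \<longleftrightarrow> (y, x) \<notin> H"
    by (rule extend_to_orientation)
  have wt: "1 \<le> wt {} x" "x \<in> D \<Longrightarrow> wt {} x = 2" for x by (auto simp: wt_def)
  have enter: "\<exists>u\<in>U. \<exists>k. (u, x) \<in> H ^^ k \<and> k \<le> wt {} u" if x: "x \<in> V" for x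
  proof -
    consider "x \<in> U" | "x \<in> I" | "x \<in> V - U - I" using x by blast
    then show ?thesis
    proof cases
      case 1
      have "(x, x) \<in> H ^^ 0" by simp
      then show ?thesis using 1 by blast
    next
      case 2
      then have "(d x, x) \<in> H ^^ 1" using H(1) by (auto simp: B_def)
      then show ?thesis using dU[of x] wt(1)[of "d x"] IV 2 by blast
    next
      case 3
      then obtain a where a: "a \<in> I" "(a, x) \<in> E" using nbr by blast
      have av: "a \<in> V - U" using a IV by blast
      then have "x \<noteq> d a" using dU 3 by blast
      then have "(d a, a) \<in> H" "(a, x) \<in> H" using a H(1) by (auto simp: B_def)
      then have "(d a, x) \<in> H ^^ 2" by (auto simp: numeral_2_eq_2)
      then show ?thesis using dU[OF av] wt(2)[OF d(1)[OF av]] by (intro bexI[of _ "d a"] exI[of _ 2]) auto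
    qed
  qed
  have leave: "\<exists>u\<in>U. \<exists>k. (x, u) \<in> H ^^ k \<and> k \<le> wt {} u" if x: "x \<in> V" for x
  proof -
    consider "x \<in> U" | "x \<in> I" | "x \<in> V - U - I" using x by blast
    then show ?thesis
    proof cases
      case 1
      have "(x, x) \<in> H ^^ 0" by simp
      then show ?thesis using 1 by blast
    next
      case 2
      have xv: "x \<in> V - U" using 2 IV by blast
      \<comment> \<open>Bridgelessness supplies an edge at \<open>x\<close> other than the one
        reserved for entering it from \<open>d x\<close>.\<close>
      have rel: "(x, d x) \<in> (E - {(x, d x), (d x, x)})\<^sup>*" using bridgeless[OF d(2)[OF xv]] .
      have ne: "x \<noteq> d x" using dU[OF xv] xv by auto
      obtain w where "(x, w) \<in> E - {(x, d x), (d x, x)}"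
        by (rule converse_rtranclE[OF rel]) (use ne in blast)+
      then have w: "(x, w) \<in> E" "w \<noteq> d x" by simp_all
      then have xw: "(x, w) \<in> H" using 2 H(1) by (auto simp: B_def)
      show ?thesis
      proof (cases "w \<in> U")
        case True
        have "(x, w) \<in> H ^^ 1" using xw by simp
        then show ?thesis using True wt(1)[of w] by blast
      next
        case False
        then have wv: "w \<in> V - U - I" using w indep 2 E_subset by blast
        then have "(w, d w) \<in> H" using H(1) by (auto simp: B_def)
        then have "(x, d w) \<in> H ^^ 2" using xw by (auto simp: numeral_2_eq_2)
        then show ?thesis using dU[of w] wt(2)[OF d(1), of w] wv by (intro bexI[of _ "d w"] exI[of _ 2]) auto
      qed
    next
      case 3
      then have "(x, d x) \<in> H ^^ 1" using H(1) by (auto simp: B_def)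
      then show ?thesis using dU[of x] wt(1)[of "d x"] 3 by blast
    qed
  qed
  have "\<exists>k. (x, y) \<in> H ^^ k \<and> k \<le> 4 * card D" if xy: "x \<in> V" "y \<in> V" for x y
  proof -
    obtain u k where u: "u \<in> U" "(x, u) \<in> H ^^ k" "k \<le> wt {} u" using leave[OF xy(1)] by blast
    obtain v l where v: "v \<in> U" "(v, y) \<in> H ^^ l" "l \<le> wt {} v" using enter[OF xy(2)] by blast
    obtain i where i: "(u, v) \<in> A ^^ i" "i + wt {} u + wt {} v \<le> 4 * card D" using A(3) u(1) v(1) by blast
    have "A \<subseteq> H" using H(1) by (auto simp: B_def)
    then have "(x, y) \<in> H ^^ (k + (i + l))"
      using relpow_trans[OF u(2) relpow_trans[OF relpow_mono_subset[OF _ i(1)] v(2)]] by blast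
    then show ?thesis using i(2) u(3) v(3) by (intro exI[of _ "k + (i + l)"]) auto
  qed
  then show thesis using that[OF H(2,3)] by blast
qed

end

subsection \<open>Transfer to digraphs\<close>

text \<open>Powers of the arc relation yield walks, while distances are taken over paths; removing
  cycles does not lengthen a walk.\<close>

lemma (in wf_digraph) length_awalk_to_apath:
  assumes "awalk u p v"
  shows "length (awalk_to_apath p) \<le> length p"
  using assms
proof (induct rule: awalk_to_apath_induct)
  case (path p)
  then have "awalk_to_apath p = p" by (auto simp: awalk_to_apath.simps)
  then show ?case by simp
next
  case (decomp p q r s)
  then have "awalk_to_apath p = awalk_to_apath (q @ s)" using step_awalk_to_apath by simp
  moreover have "p = q @ r @ s" using decomp(1-3) by (auto elim: awalk_cyc_decompE)
  ultimately show ?case using decomp by simp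
qed

lemma (in pair_wf_digraph) relpow_awalk:
  assumes "(x, y) \<in> parcs G ^^ k" "x \<in> pverts G"
  shows "\<exists>p. awalk x p y \<and> length p = k"
  using assms
proof (induction k arbitrary: y)
  case 0
  then show ?case by (auto simp: awalk_Nil_iff intro!: exI[of _ "[]"])
next
  case (Suc k)
  then obtain z where z: "(x, z) \<in> parcs G ^^ k" "(z, y) \<in> parcs G" by auto
  then obtain p where "awalk x p z" "length p = k" using Suc by blast
  moreover have "awalk z [(z, y)] y" using z(2) in_arcsD1 in_arcsD2 by (auto simp: awalk_Cons_iff awalk_Nil_iff)
  ultimately show ?case by (intro exI[of _ "p @ [(z, y)]"]) (auto intro: awalk_appendI)
qed

lemma directed_dist_le:
  assumes "pair_wf_digraph H" "(x, y) \<in> parcs H ^^ k" "x \<in> pverts H"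
  shows "directed_dist H x y \<le> enat k"
proof -
  interpret pair_wf_digraph H by fact
  obtain p where p: "awalk x p y" "length p = k" using relpow_awalk assms by blast
  have "apath x (awalk_to_apath p) y" using p(1) by (rule apath_awalk_to_apath)
  moreover have "enat (length (awalk_to_apath p)) \<le> enat k" using length_awalk_to_apath[OF p(1)] p(2) by simp
  ultimately show ?thesis unfolding directed_dist_def by (intro INF_lower2) auto
qed

lemma connected_imp_rtrancl:
  assumes "Digraph_Component.connected (with_proj G)" "sym (parcs G)" "u \<in> pverts G" "v \<in> pverts G"
  shows "(u, v) \<in> (parcs G)\<^sup>*"
proof -
  have "parcs (mk_symmetric (with_proj G)) = parcs G"
    using assms(2) by (auto simp: parcs_mk_symmetric dest: symD)
  then show ?thesis
    using assms by (auto simp: Digraph_Component.connected_def strongly_connected_def reachable_def dest: rtrancl_on_rtranclI)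
qed

lemma domination_number_attained:
  assumes "finite (pverts G)"
  obtains D where "dominating_set G D" "card D = domination_number G"
proof -
  have "{D. dominating_set G D} \<subseteq> Pow (pverts G)" by (auto simp: dominating_set_def)
  then have "finite {D. dominating_set G D}" using assms by (simp add: finite_subset)
  moreover have "dominating_set G (pverts G)" by (simp add: dominating_set_def)
  ultimately have "domination_number G \<in> card ` {D. dominating_set G D}"
    unfolding domination_number_def by (intro Min_in) auto
  then show thesis using that by auto
qed

lemma bridgeless_connected_oriented_diam:
  assumes "bridgeless_connected G"
  shows "\<exists>H. strong_orientation G H \<and> directed_diam H \<le> enat (4 * domination_number G)"
proof -
  have pg: "pair_graph G" and conn: "Digraph_Component.connected (with_proj G)"
    and del: "\<And>u v. (u, v) \<in> parcs G \<Longrightarrow> Digraph_Component.connected (with_proj (delete_edge G u v))"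
    using assms by (auto simp: bridgeless_connected_def)
  interpret pair_graph G by fact
  have sym: "sym (parcs G)" using pair_sym_arcs by (simp add: symmetric_def)
  obtain D where D: "dominating_set G D" "card D = domination_number G"
    using domination_number_attained[OF pair_finite_verts] .
  interpret B: bridgeless_dominated_graph "pverts G" "parcs G" D
  proof
    show "finite (pverts G)" by (rule pair_finite_verts)
    show "pverts G \<noteq> {}" using conn
      by (auto simp: Digraph_Component.connected_def strongly_connected_def)
    show "parcs G \<subseteq> pverts G \<times> pverts G" using in_arcsD1 in_arcsD2 by auto
    show "(y, x) \<in> parcs G" if "(x, y) \<in> parcs G" for x y using sym that by (rule symD)
    show "(x, x) \<notin> parcs G" for x using pair_no_loops[of "(x, x)"] by auto
    show "(x, y) \<in> (parcs G)\<^sup>*" if "x \<in> pverts G" "y \<in> pverts G" for x y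
      using connected_imp_rtrancl[OF conn sym that] .
    show "(x, y) \<in> (parcs G - {(x, y), (y, x)})\<^sup>*" if e: "(x, y) \<in> parcs G" for x y
    proof -
      have "sym (parcs (delete_edge G x y))" using sym by (auto simp: delete_edge_def sym_def)
      from connected_imp_rtrancl[OF del[OF e] this, of x y] show ?thesis
        using in_arcsD1[OF e] in_arcsD2[OF e] by (simp add: delete_edge_def)
    qed
    show "D \<subseteq> pverts G" using D(1) by (simp add: dominating_set_def)
    show "\<exists>d\<in>D. (x, d) \<in> parcs G" if "x \<in> pverts G - D" for x
      using D(1) that by (simp add: dominating_set_def)
  qed
  obtain R where R: "R \<subseteq> parcs G" "\<forall>(x, y)\<in>parcs G. (x, y) \<in> R \<longleftrightarrow> (y, x) \<notin> R"
    "\<forall>x\<in>pverts G. \<forall>y\<in>pverts G. \<exists>k. (x, y) \<in> R ^^ k \<and> k \<le> 4 * card D"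
    by (rule B.exists_short_orientation)
  define H where "H = \<lparr>pverts = pverts G, parcs = R\<rparr>"
  have H: "pverts H = pverts G" "parcs H = R" by (simp_all add: H_def)
  have wf: "pair_wf_digraph H"
    using R(1) in_arcsD1 in_arcsD2 by unfold_locales (auto simp: H)
  have dist: "directed_dist H x y \<le> enat (4 * domination_number G)" if xy: "x \<in> pverts H" "y \<in> pverts H" for x y
  proof -
    obtain k where "(x, y) \<in> R ^^ k" "k \<le> 4 * card D" using R(3) xy H(1) by blast
    then show ?thesis using directed_dist_le[OF wf, of x y k] xy(1) D(2) H(2)
      by (simp add: order_trans[of _ "enat k"])
  qed
  have "strongly_connected (with_proj H)"
  proof -
    interpret H: pair_wf_digraph H by (rule wf)
    have "x \<rightarrow>\<^sup>*\<^bsub>with_proj H\<^esub> y" if xy: "x \<in> pverts H" "y \<in> pverts H" for x y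
    proof -
      obtain k where "(x, y) \<in> R ^^ k" using R(3) xy H(1) by blast
      then obtain p where "H.awalk x p y" using H.relpow_awalk[of x y k] xy(1) H(2) by auto
      then show ?thesis by (rule H.reachable_awalkI)
    qed
    then show ?thesis using B.V_nonempty H(1) by (simp add: strongly_connected_def)
  qed
  moreover have "orientation G H" using R(1,2) by (auto simp: orientation_def H)
  moreover have "directed_diam H \<le> enat (4 * domination_number G)"
    unfolding directed_diam_def by (intro SUP_least dist)
  ultimately show ?thesis unfolding strong_orientation_def by blast
qed

theorem theorem2:
  shows "(\<forall>\<gamma> \<ge> 1. Xi \<gamma> \<le> enat (4 * \<gamma>)) \<and>
         (\<forall>G :: 'a pair_pre_digraph. bridgeless_connected G \<longrightarrow>
            (\<exists>H. strong_orientation G H \<and> directed_diam H \<le> enat (4 * domination_number G)))"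
proof (intro conjI allI impI)
  fix \<gamma> :: nat assume "1 \<le> \<gamma>"
  have "min_oriented_diam G \<le> enat (4 * \<gamma>)"
    if G: "bridgeless_connected G" "domination_number G \<le> \<gamma>" for G :: "nat pair_pre_digraph"
  proof -
    obtain H where "strong_orientation G H" "directed_diam H \<le> enat (4 * domination_number G)"
      using bridgeless_connected_oriented_diam[OF G(1)] by blast
    moreover have "enat (4 * domination_number G) \<le> enat (4 * \<gamma>)" using G(2) by simp
    ultimately have "directed_diam H \<le> enat (4 * \<gamma>)" "H \<in> {H. strong_orientation G H}"
      using order_trans by blast+
    then show ?thesis unfolding min_oriented_diam_def by (intro INF_lower2)
  qed
  then show "Xi \<gamma> \<le> enat (4 * \<gamma>)" unfolding Xi_def by (intro SUP_least) auto
qed (rule bridgeless_connected_oriented_diam)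

end
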